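(* Let $G=(V,E)$ be a directed graph with $n$ vertices and $m$ edges. All the $3$-vertex-connected components of $G$ can be computed in $O(n^{3}m)$ time.
   Context: For $U\subseteq V$, $G[U]$ is the induced subgraph. $G$ is $k$-vertex-connected if it has at least $k+1$ vertices and $G[V\setminus X]$ is strongly connected for every $X\subset V$ with $|X|<k$. The $k$-vertex-connected components of $G$ are its maximal $k$-vertex-connected subgraphs (identified with vertex sets $C$, subgraph $G[C]$). *)

theory Defs
  imports "Graph_Theory.Digraph_Component" "Graph_Theory.Pair_Digraph"
begin

section \<open>\<open>k\<close>-vertex-connected components\<close>

definition k_vertex_connected :: "nat \<Rightarrow> ('a, 'b) pre_digraph \<Rightarrow> bool" where
  "k_vertex_connected k G \<longleftrightarrow>
     card (verts G) \<ge> k + 1 \<and>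
     (\<forall>X. X \<subset> verts G \<and> card X < k \<longrightarrow> strongly_connected (G \<restriction> (verts G - X)))"

text \<open>
  The maximal subgraphs, in the subgraph order (removal of vertices and arcs), that are
  \<open>k\<close>-vertex-connected; each is identified with its vertex set, as adding arcs preserves
  \<open>k\<close>-vertex-connectivity and so every maximal one is induced.
\<close>

definition vertex_connected_components :: "nat \<Rightarrow> ('a, 'b) pre_digraph \<Rightarrow> 'a set set" where
  "vertex_connected_components k G =
     {verts C | C. pre_digraph.max_subgraph G (k_vertex_connected k) C}"


section \<open>Word RAM programs\<close>

text \<open>
  The machine model is a word RAM, programmed in a structured language with finitely many
  registers and arrays per program. Every elementary operation costs one time unit. The
  parameter \<open>W\<close> of the semantics is the largest number that fits into a machine word: a
  program whose evaluation produces a number above \<open>W\<close> (array indices included) is stuck,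
  i.e. has no execution. Without such a bound, unit cost multiplication would be unrealistically
  powerful. Subtraction is truncated at zero.
\<close>

datatype exp =
    Const nat
  | Reg string
  | Read string exp
  | Add exp exp
  | Sub exp exp
  | Mul exp exp
  | Div exp exp
  | Mod exp exp

datatype test =
    Less exp exp
  | Equal exp exp
  | Neg test
  | Conj test test

datatype com =
    Skip
  | Assign string exp
  | Write string exp exp
  | Seq com com
  | If test com com
  | While test com

record state =
  reg :: "string \<Rightarrow> nat"
  arr :: "string \<Rightarrow> nat \<Rightarrow> nat"

primrec eval_exp :: "exp \<Rightarrow> state \<Rightarrow> nat" where
  "eval_exp (Const a) s = a"
| "eval_exp (Reg x) s = reg s x"
| "eval_exp (Read a e) s = arr s a (eval_exp e s)"
| "eval_exp (Add e f) s = eval_exp e s + eval_exp f s"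
| "eval_exp (Sub e f) s = eval_exp e s - eval_exp f s"
| "eval_exp (Mul e f) s = eval_exp e s * eval_exp f s"
| "eval_exp (Div e f) s = eval_exp e s div eval_exp f s"
| "eval_exp (Mod e f) s = eval_exp e s mod eval_exp f s"

primrec fits_exp :: "nat \<Rightarrow> exp \<Rightarrow> state \<Rightarrow> bool" where
  "fits_exp W (Const a) s \<longleftrightarrow> a \<le> W"
| "fits_exp W (Reg x) s \<longleftrightarrow> reg s x \<le> W"
| "fits_exp W (Read a e) s \<longleftrightarrow> fits_exp W e s \<and> arr s a (eval_exp e s) \<le> W"
| "fits_exp W (Add e f) s \<longleftrightarrow> fits_exp W e s \<and> fits_exp W f s \<and> eval_exp e s + eval_exp f s \<le> W"
| "fits_exp W (Sub e f) s \<longleftrightarrow> fits_exp W e s \<and> fits_exp W f s"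
| "fits_exp W (Mul e f) s \<longleftrightarrow> fits_exp W e s \<and> fits_exp W f s \<and> eval_exp e s * eval_exp f s \<le> W"
| "fits_exp W (Div e f) s \<longleftrightarrow> fits_exp W e s \<and> fits_exp W f s"
| "fits_exp W (Mod e f) s \<longleftrightarrow> fits_exp W e s \<and> fits_exp W f s"

primrec cost_exp :: "exp \<Rightarrow> nat" where
  "cost_exp (Const a) = 1"
| "cost_exp (Reg x) = 1"
| "cost_exp (Read a e) = 1 + cost_exp e"
| "cost_exp (Add e f) = 1 + cost_exp e + cost_exp f"
| "cost_exp (Sub e f) = 1 + cost_exp e + cost_exp f"
| "cost_exp (Mul e f) = 1 + cost_exp e + cost_exp f"
| "cost_exp (Div e f) = 1 + cost_exp e + cost_exp f"
| "cost_exp (Mod e f) = 1 + cost_exp e + cost_exp f"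

primrec eval_test :: "test \<Rightarrow> state \<Rightarrow> bool" where
  "eval_test (Less e f) s \<longleftrightarrow> eval_exp e s < eval_exp f s"
| "eval_test (Equal e f) s \<longleftrightarrow> eval_exp e s = eval_exp f s"
| "eval_test (Neg b) s \<longleftrightarrow> \<not> eval_test b s"
| "eval_test (Conj b c) s \<longleftrightarrow> eval_test b s \<and> eval_test c s"

primrec fits_test :: "nat \<Rightarrow> test \<Rightarrow> state \<Rightarrow> bool" where
  "fits_test W (Less e f) s \<longleftrightarrow> fits_exp W e s \<and> fits_exp W f s"
| "fits_test W (Equal e f) s \<longleftrightarrow> fits_exp W e s \<and> fits_exp W f s"
| "fits_test W (Neg b) s \<longleftrightarrow> fits_test W b s"
| "fits_test W (Conj b c) s \<longleftrightarrow> fits_test W b s \<and> fits_test W c s"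

primrec cost_test :: "test \<Rightarrow> nat" where
  "cost_test (Less e f) = 1 + cost_exp e + cost_exp f"
| "cost_test (Equal e f) = 1 + cost_exp e + cost_exp f"
| "cost_test (Neg b) = 1 + cost_test b"
| "cost_test (Conj b c) = 1 + cost_test b + cost_test c"

definition set_reg :: "string \<Rightarrow> nat \<Rightarrow> state \<Rightarrow> state" where
  "set_reg x v s = s\<lparr>reg := (reg s)(x := v)\<rparr>"

definition set_arr :: "string \<Rightarrow> nat \<Rightarrow> nat \<Rightarrow> state \<Rightarrow> state" where
  "set_arr a i v s = s\<lparr>arr := (arr s)(a := (arr s a)(i := v))\<rparr>"

text \<open>\<open>exec W c s t s'\<close>: started in \<open>s\<close>, program \<open>c\<close> halts after \<open>t\<close> time units in \<open>s'\<close>.\<close>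

inductive exec :: "nat \<Rightarrow> com \<Rightarrow> state \<Rightarrow> nat \<Rightarrow> state \<Rightarrow> bool" for W where
  Skip: "exec W Skip s 1 s"
| Assign: "fits_exp W e s \<Longrightarrow>
    exec W (Assign x e) s (1 + cost_exp e) (set_reg x (eval_exp e s) s)"
| Write: "fits_exp W e s \<Longrightarrow> fits_exp W f s \<Longrightarrow>
    exec W (Write a e f) s (1 + cost_exp e + cost_exp f) (set_arr a (eval_exp e s) (eval_exp f s) s)"
| Seq: "exec W c s t s' \<Longrightarrow> exec W d s' t' s'' \<Longrightarrow> exec W (Seq c d) s (t + t') s''"
| IfTrue: "fits_test W b s \<Longrightarrow> eval_test b s \<Longrightarrow> exec W c s t s' \<Longrightarrow>
    exec W (If b c d) s (1 + cost_test b + t) s'"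
| IfFalse: "fits_test W b s \<Longrightarrow> \<not> eval_test b s \<Longrightarrow> exec W d s t s' \<Longrightarrow>
    exec W (If b c d) s (1 + cost_test b + t) s'"
| WhileFalse: "fits_test W b s \<Longrightarrow> \<not> eval_test b s \<Longrightarrow>
    exec W (While b c) s (1 + cost_test b) s"
| WhileTrue: "fits_test W b s \<Longrightarrow> eval_test b s \<Longrightarrow> exec W c s t s' \<Longrightarrow>
    exec W (While b c) s' t' s'' \<Longrightarrow> exec W (While b c) s (1 + cost_test b + t + t') s''"

text \<open>
  Executions are deterministic, so the existence of an execution with some running time
  and result is the same as termination with that running time and result.
\<close>

lemma exec_deterministic:
  "exec W c s t s' \<Longrightarrow> exec W c s u r \<Longrightarrow> t = u \<and> s' = r"
proof (induction arbitrary: u r rule: exec.induct)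
  case (Skip s)
  then show ?case by (cases rule: exec.cases) auto
next
  case (Assign e s x)
  from Assign.prems show ?case by (cases rule: exec.cases) auto
next
  case (Write e s f a)
  from Write.prems show ?case by (cases rule: exec.cases) auto
next
  case (Seq c s t s' d t' s'')
  from Seq.prems obtain t1 s1 t2 where
    1: "exec W c s t1 s1" and 2: "exec W d s1 t2 r" and u: "u = t1 + t2"
    by (cases rule: exec.cases) auto
  from Seq.IH(1)[OF 1] have "t = t1" "s' = s1" by auto
  with Seq.IH(2)[of t2 r] 2 u show ?case by simp
next
  case (IfTrue b s c t s' d)
  from IfTrue.prems IfTrue.hyps(2) obtain t1 where
    1: "exec W c s t1 r" and u: "u = 1 + cost_test b + t1"
    by (cases rule: exec.cases) auto
  from IfTrue.IH[OF 1] u show ?case by simp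
next
  case (IfFalse b s d t s' c)
  from IfFalse.prems IfFalse.hyps(2) obtain t1 where
    1: "exec W d s t1 r" and u: "u = 1 + cost_test b + t1"
    by (cases rule: exec.cases) auto
  from IfFalse.IH[OF 1] u show ?case by simp
next
  case (WhileFalse b s c)
  from WhileFalse.prems WhileFalse.hyps(2) show ?case
    by (cases rule: exec.cases) auto
next
  case (WhileTrue b s c t s' t' s'')
  from WhileTrue.prems WhileTrue.hyps(2) obtain t1 s1 t2 where
    1: "exec W c s t1 s1" and 2: "exec W (While b c) s1 t2 r" and
    u: "u = 1 + cost_test b + t1 + t2"
    by (cases rule: exec.cases) auto
  from WhileTrue.IH(1)[OF 1] have "t = t1" "s' = s1" by auto
  with WhileTrue.IH(2)[of t2 r] 2 u show ?case by simp
qed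


section \<open>Input and output of graphs\<close>

text \<open>
  A graph is presented by a numbering \<open>vs\<close> of its vertices and a list \<open>es\<close> of its arcs, in any
  order, as pairs of vertex numbers. The machine sees only the numbers of vertices and arcs and the
  two arrays of arc ends; all other memory is initially zero.
\<close>

definition represents :: "'a list \<Rightarrow> (nat \<times> nat) list \<Rightarrow> 'a pair_pre_digraph \<Rightarrow> bool" where
  "represents vs es G \<longleftrightarrow>
     distinct vs \<and> set vs = pverts G \<and>
     distinct es \<and> set es \<subseteq> {..<length vs} \<times> {..<length vs} \<and>
     parcs G = (\<lambda>(i, j). (vs ! i, vs ! j)) ` set es"

definition input_state :: "nat \<Rightarrow> (nat \<times> nat) list \<Rightarrow> state" where
  "input_state n es =
     \<lparr>reg = (\<lambda>_. 0)(''n'' := n, ''m'' := length es),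
      arr = (\<lambda>_ _. 0)(''tail'' := (\<lambda>i. if i < length es then fst (es ! i) else 0),
                      ''head'' := (\<lambda>i. if i < length es then snd (es ! i) else 0))\<rparr>"

text \<open>
  The output is a list of \<open>reg s ''count''\<close> lists of vertex numbers: the \<open>i\<close>-th one occupies the
  cells of the array \<open>''out''\<close> from position \<open>arr s ''start'' i\<close> to just before
  \<open>arr s ''start'' (i + 1)\<close>.
\<close>

definition output_lists :: "state \<Rightarrow> nat list list" where
  "output_lists s =
     map (\<lambda>i. map (arr s ''out'') [arr s ''start'' i ..< arr s ''start'' (i + 1)])
       [0 ..< reg s ''count'']"

text \<open>Every member of the family is listed exactly once, and so is each of its vertices.\<close>

definition outputs_family :: "'a list \<Rightarrow> state \<Rightarrow> 'a set set \<Rightarrow> bool" where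
  "outputs_family vs s F \<longleftrightarrow>
     (\<forall>xs \<in> set (output_lists s). distinct xs \<and> set xs \<subseteq> {..<length vs}) \<and>
     distinct (map set (output_lists s)) \<and>
     (\<lambda>xs. (!) vs ` set xs) ` set (output_lists s) = F"

text \<open>
  One program, one time constant and one word length exponent must serve all graphs; words
  hold numbers up to \<open>(n + m + 2) ^ d\<close>, i.e. they have \<open>O(log (n + m))\<close> bits.
  The function \<open>T\<close> bounds the time in terms of the numbers of vertices and arcs, up to
  the constant factor \<open>c\<close>.
\<close>

definition computable_in_time ::
    "('a pair_pre_digraph \<Rightarrow> 'a set set) \<Rightarrow> (nat \<Rightarrow> nat \<Rightarrow> nat) \<Rightarrow> bool" where
  "computable_in_time f T \<longleftrightarrow>
     (\<exists>P c d. \<forall>G vs es. pair_fin_digraph G \<and> represents vs es G \<longrightarrow>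
        (let n = card (pverts G); m = card (parcs G) in
          \<exists>t s. exec ((n + m + 2) ^ d) P (input_state n es) t s \<and>
                t \<le> c * T n m \<and>
                outputs_family vs s (f G)))"

end

theory Submission
  imports Defs
begin

text \<open>
  If a set \<open>U\<close> of vertices contains \<open>x \<noteq> y\<close> such that some proper nonempty \<open>S\<close> inside \<open>U - {x, y}\<close> is
  closed under the arcs (or under the reversed arcs) of \<open>U - {x, y}\<close>, then every
  3-vertex-connected subset of \<open>U\<close> lies in \<open>S \<union> {x, y}\<close> or in \<open>U - S\<close>; if there are no such \<open>x\<close>, \<open>y\<close>, \<open>S\<close>
  and \<open>U\<close> has at least four vertices, then \<open>U\<close> is 3-vertex-connected. So one splits sets until this is no
  longer possible, starting with the set of tails of arcs, which has at most \<open>min n m\<close> elements.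
  The two parts overlap in two vertices only. Hence the sum of \<open>card U - 3\<close> over the current sets drops
  with every splitting, so that \<open>O(min n m)\<close> sets are tested altogether, and no resulting set of
  at least four vertices is contained in another one. Testing a set takes two graph searches for each
  pair \<open>x\<close>, \<open>y\<close>, that is \<open>O(n\<^sup>2 (n + m))\<close> time, which makes \<open>O(n\<^sup>3 m)\<close> in total.
\<close>

section \<open>Weakest preconditions with elapsed time\<close>

text \<open>The offset 3 is forced by the overlap. A set \<open>U\<close> with \<open>u\<close>
  elements, split along \<open>S\<close> with \<open>s\<close> elements, yields parts of sizes
  \<open>s + 2\<close> and \<open>u - s\<close>. With offset 2 the sum would stay the same, with
  offset 3 it drops from \<open>u - 3\<close> to \<open>u - 4\<close>. Both parts have at least
  three elements, so truncated subtraction hides nothing.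

  Starting with the tails rather than with all vertices matters for sparse graphs:
  \<open>n * (n + m)\<close> is not \<open>O(n * m)\<close> when \<open>m\<close> is small compared
  with \<open>n\<close>, whereas \<open>min n m * (n + m)\<close> is at most
  \<open>2 * n * m\<close>.

  One root per pair \<open>x\<close>, \<open>y\<close> is enough. A search along the arcs and one
  along the reversed arcs either both visit all of \<open>U - {x, y}\<close>, which is then strongly
  connected through the root, or one of them stops early, and the visited vertices are the closed
  set \<open>S\<close> of a splitting. A pair that does not separate \<open>U\<close> may separate a
  part of \<open>U\<close>, so after a splitting the scan of pairs starts again; the abandoned scan
  is charged to the splitting.\<close>

definition wp :: "nat \<Rightarrow> com \<Rightarrow> (state \<Rightarrow> nat \<Rightarrow> bool) \<Rightarrow> state \<Rightarrow> nat \<Rightarrow> bool" where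
  "wp W c Q s t \<longleftrightarrow> (\<exists>t' s'. exec W c s t' s' \<and> Q s' (t + t'))"

primrec wregs :: "com \<Rightarrow> string set" where
  "wregs Skip = {}"
| "wregs (Assign x e) = {x}"
| "wregs (Write a e f) = {}"
| "wregs (Seq c d) = wregs c \<union> wregs d"
| "wregs (If b c d) = wregs c \<union> wregs d"
| "wregs (While b c) = wregs c"

primrec warrs :: "com \<Rightarrow> string set" where
  "warrs Skip = {}"
| "warrs (Assign x e) = {}"
| "warrs (Write a e f) = {a}"
| "warrs (Seq c d) = warrs c \<union> warrs d"
| "warrs (If b c d) = warrs c \<union> warrs d"
| "warrs (While b c) = warrs c"

text \<open>A syntactic frame condition. Since \<open>wp_While\<close> and \<open>wp_conseq\<close>
  supply it, invariants and postconditions mention only what the code in question changes.\<close>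

definition same :: "com \<Rightarrow> state \<Rightarrow> state \<Rightarrow> bool" where
  "same c s s' \<longleftrightarrow>
     (\<forall>x. x \<notin> wregs c \<longrightarrow> reg s' x = reg s x) \<and> (\<forall>a. a \<notin> warrs c \<longrightarrow> arr s' a = arr s a)"

lemma reg_set_reg [simp]: "reg (set_reg x v s) = (reg s)(x := v)"
  and arr_set_reg [simp]: "arr (set_reg x v s) = arr s"
  and reg_set_arr [simp]: "reg (set_arr a i v s) = reg s"
  and arr_set_arr [simp]: "arr (set_arr a i v s) = (arr s)(a := (arr s a)(i := v))"
  by (simp_all add: set_reg_def set_arr_def)

lemma same_refl [simp]: "same c s s"
  by (simp add: same_def)

lemma same_trans: "same c s s' \<Longrightarrow> same c s' s'' \<Longrightarrow> same c s s''"
  by (simp add: same_def)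

lemma exec_same: "exec W c s t s' \<Longrightarrow> same c s s'"
  by (induction rule: exec.induct) (auto simp: same_def)

lemma wp_Skip [simp]: "wp W Skip Q s t \<longleftrightarrow> Q s (t + 1)"
  unfolding wp_def by (auto intro!: exI[of _ "1"] exec.Skip[simplified] elim: exec.cases)

lemma wp_Assign [simp]:
  "wp W (Assign x e) Q s t \<longleftrightarrow> fits_exp W e s \<and> Q (set_reg x (eval_exp e s) s) (t + (1 + cost_exp e))"
  unfolding wp_def by (auto intro!: exec.Assign exI elim: exec.cases)

lemma wp_Write [simp]:
  "wp W (Write a e f) Q s t \<longleftrightarrow> fits_exp W e s \<and> fits_exp W f s \<and>
     Q (set_arr a (eval_exp e s) (eval_exp f s) s) (t + (1 + cost_exp e + cost_exp f))"
  unfolding wp_def by (auto intro!: exec.Write exI elim: exec.cases)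

text \<open>Holds with no arithmetic on durations because a postcondition receives the reading of a
  running clock, not the time spent in the command.\<close>

lemma wp_Seq [simp]: "wp W (Seq c d) Q = wp W c (wp W d Q)"
proof (intro ext iffI)
  fix s t
  assume "wp W (Seq c d) Q s t"
  then obtain t' s' where 1: "exec W (Seq c d) s t' s'" and q: "Q s' (t + t')"
    by (auto simp: wp_def)
  from 1 obtain t1 s1 t2 where "exec W c s t1 s1" "exec W d s1 t2 s'" "t' = t1 + t2"
    by (cases rule: exec.cases) auto
  with q show "wp W c (wp W d Q) s t"
    unfolding wp_def by (metis add.assoc)
next
  fix s t
  assume "wp W c (wp W d Q) s t"
  then show "wp W (Seq c d) Q s t"
    unfolding wp_def by (metis add.assoc exec.Seq)
qed

lemma wp_If [simp]:
  "wp W (If b c d) Q s t \<longleftrightarrow> fits_test W b s \<and>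
     (if eval_test b s then wp W c Q s (t + (1 + cost_test b)) else wp W d Q s (t + (1 + cost_test b)))"
  (is "?l \<longleftrightarrow> ?r")
proof
  assume ?l
  then obtain t' s' where 1: "exec W (If b c d) s t' s'" and q: "Q s' (t + t')"
    by (auto simp: wp_def)
  from 1 show ?r
    by (cases rule: exec.cases) (use q in \<open>auto simp: wp_def add.assoc intro!: exI\<close>)
next
  assume r: ?r
  show ?l
  proof (cases "eval_test b s")
    case True
    with r obtain t' s' where "exec W c s t' s'" "Q s' (t + (1 + cost_test b) + t')"
      by (auto simp: wp_def)
    with r True show ?thesis
      unfolding wp_def by (metis exec.IfTrue add.assoc)
  next
    case False
    with r obtain t' s' where "exec W d s t' s'" "Q s' (t + (1 + cost_test b) + t')"
      by (auto simp: wp_def)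
    with r False show ?thesis
      unfolding wp_def by (metis exec.IfFalse add.assoc)
  qed
qed

lemma wp_conseq:
  assumes "wp W c Q s t" and "\<And>s' t'. Q s' t' \<Longrightarrow> same c s s' \<Longrightarrow> Q' s' t'"
  shows "wp W c Q' s t"
  using assms exec_same unfolding wp_def by blast

text \<open>
  Each evaluation of the loop condition takes time, so a bound \<open>B\<close> on the time elapsed at
  the loop head takes the place of a variant.
\<close>

lemma wp_While:
  assumes I: "I s0 t0"
    and head: "\<And>s t. I s t \<Longrightarrow> same c s0 s \<Longrightarrow> t \<le> B \<and> fits_test W b s"
    and step: "\<And>s t. I s t \<Longrightarrow> same c s0 s \<Longrightarrow> eval_test b s \<Longrightarrow> wp W c I s (t + (1 + cost_test b))"
    and exit: "\<And>s t. I s t \<Longrightarrow> same c s0 s \<Longrightarrow> \<not> eval_test b s \<Longrightarrow> Q s (t + (1 + cost_test b))"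
  shows "wp W (While b c) Q s0 t0"
proof -
  have "wp W (While b c) Q s t" if "I s t" "same c s0 s" for s t
    using that
  proof (induction "B - t" arbitrary: s t rule: less_induct)
    case less
    note h = head[OF less.prems]
    show ?case
    proof (cases "eval_test b s")
      case True
      from step[OF less.prems True] obtain t1 s1
        where e: "exec W c s t1 s1" and i: "I s1 (t + (1 + cost_test b) + t1)"
        by (auto simp: wp_def)
      have sm: "same c s0 s1" using less.prems(2) exec_same[OF e] by (rule same_trans)
      have "wp W (While b c) Q s1 (t + (1 + cost_test b) + t1)"
        using head[OF i sm] by (intro less.hyps i sm) linarith
      then obtain t2 s2 where "exec W (While b c) s1 t2 s2" "Q s2 (t + (1 + cost_test b) + t1 + t2)"
        by (auto simp: wp_def)
      moreover from this(1) have "exec W (While b c) s (1 + cost_test b + t1 + t2) s2"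
        using h True e by (blast intro: exec.WhileTrue)
      ultimately show ?thesis
        unfolding wp_def by (metis add.assoc)
    next
      case False
      with h exit[OF less.prems False] show ?thesis
        unfolding wp_def by (metis exec.WhileFalse)
    qed
  qed
  with I show ?thesis by simp
qed

section \<open>The program\<close>

abbreviation (input) seq (infixr \<open>;;\<close> 60) where "c ;; d \<equiv> Seq c d"

abbreviation "incr x \<equiv> Assign x (Add (Reg x) (Const 1))"

text \<open>
  Node \<open>v\<close> below \<open>n\<close> stands for vertex \<open>v\<close> with its outgoing arcs, node
  \<open>n + v\<close> for \<open>v\<close> with its incoming arcs. The other ends of the arcs of node \<open>p\<close> are listed in
  \<open>''adj''\<close> from position \<open>''off'' p\<close> to just before \<open>''off'' (p + 1)\<close>.
\<close>

definition arc_body :: com where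
  "arc_body =
     (If (Equal (Read ''tail'' (Reg ''e'')) (Reg ''p''))
        (Write ''adj'' (Reg ''c'') (Read ''head'' (Reg ''e'')) ;; incr ''c'') Skip ;;
      If (Equal (Add (Read ''head'' (Reg ''e'')) (Reg ''n'')) (Reg ''p''))
        (Write ''adj'' (Reg ''c'') (Read ''tail'' (Reg ''e'')) ;; incr ''c'') Skip ;;
      incr ''e'')"

text \<open>Rescanning all arcs for each node costs \<open>O((n + 1) * (m + 1))\<close> altogether,
  which the time bound easily absorbs.\<close>

definition node_body :: com where
  "node_body =
     (Write ''off'' (Reg ''p'') (Reg ''c'') ;;
      Assign ''e'' (Const 0) ;;
      While (Less (Reg ''e'') (Reg ''m'')) arc_body ;;
      incr ''p'')"

text \<open>The last write provides the end of the last list, so that \<open>off (p + 1)\<close> is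
  defined for every node \<open>p\<close>.\<close>

definition build_adj :: com where
  "build_adj =
     (Assign ''c'' (Const 0) ;;
      Assign ''p'' (Const 0) ;;
      While (Less (Reg ''p'') (Add (Reg ''n'') (Reg ''n''))) node_body ;;
      Write ''off'' (Reg ''p'') (Reg ''c''))"

text \<open>
  The working family of vertex sets has \<open>''k''\<close> members, stored in \<open>''row''\<close> as consecutive
  characteristic vectors of length \<open>n\<close>.
\<close>

definition mark_tail :: com where
  "mark_tail = (Write ''row'' (Read ''tail'' (Reg ''e'')) (Const 1) ;; incr ''e'')"

definition init_row :: com where
  "init_row =
     (Assign ''e'' (Const 0) ;;
      While (Less (Reg ''e'') (Reg ''m'')) mark_tail ;;
      Assign ''k'' (Const 1))"

abbreviation "cell r v \<equiv> Add (Mul (Reg r) (Reg ''n'')) (Reg v)"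

text \<open>Marks: 0 for vertices outside the subgraph searched, 1 for unvisited and 2 for visited ones.\<close>

definition clear_body :: com where
  "clear_body =
     (If (Conj (Equal (Read ''row'' (cell ''i'' ''v'')) (Const 1))
            (Conj (Neg (Equal (Reg ''v'') (Reg ''x''))) (Neg (Equal (Reg ''v'') (Reg ''y'')))))
        (If (Equal (Reg ''cnt'') (Const 0))
           (Write ''mark'' (Reg ''v'') (Const 2) ;;
            Write ''queue'' (Const 0) (Reg ''v'') ;;
            Assign ''qt'' (Const 1))
           (Write ''mark'' (Reg ''v'') (Const 1)) ;;
         incr ''cnt'')
        (Write ''mark'' (Reg ''v'') (Const 0)) ;;
      incr ''v'')"

definition clear_marks :: com where
  "clear_marks =
     (Assign ''v'' (Const 0) ;;
      Assign ''cnt'' (Const 0) ;;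
      Assign ''qt'' (Const 0) ;;
      While (Less (Reg ''v'') (Reg ''n'')) clear_body)"

text \<open>One loop instead of two nested ones: a step either inspects entry \<open>j\<close> of
  the vertex at the front of the queue or removes that vertex. \<open>base\<close> is 0 or
  \<open>n\<close> and selects the direction of the arcs. Vertices outside the searched subgraph
  have mark 0 and are never queued.\<close>

definition search_body :: com where
  "search_body =
     (Assign ''u'' (Add (Reg ''base'') (Read ''queue'' (Reg ''qh''))) ;;
      If (Less (Add (Read ''off'' (Reg ''u'')) (Reg ''j'')) (Read ''off'' (Add (Reg ''u'') (Const 1))))
        (Assign ''w'' (Read ''adj'' (Add (Read ''off'' (Reg ''u'')) (Reg ''j''))) ;;
         incr ''j'' ;;
         If (Equal (Read ''mark'' (Reg ''w'')) (Const 1))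
           (Write ''mark'' (Reg ''w'') (Const 2) ;;
            Write ''queue'' (Reg ''qt'') (Reg ''w'') ;;
            incr ''qt'')
           Skip)
        (incr ''qh'' ;; Assign ''j'' (Const 0)))"

definition search :: com where
  "search =
     (Assign ''qh'' (Const 0) ;;
      Assign ''j'' (Const 0) ;;
      While (Less (Reg ''qh'') (Reg ''qt'')) search_body)"

text \<open>Splits in place: the visited part keeps row \<open>i\<close>, the unvisited part moves
  to the new row \<open>k\<close>, and the separating vertices belong to both.\<close>

definition split_body :: com where
  "split_body =
     (If (Neg (Conj (Neg (Equal (Reg ''v'') (Reg ''x''))) (Neg (Equal (Reg ''v'') (Reg ''y'')))))
        (Write ''row'' (cell ''k'' ''v'') (Const 1))
        (If (Equal (Read ''mark'' (Reg ''v'')) (Const 2))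
           (Write ''row'' (cell ''k'' ''v'') (Const 0))
           (Write ''row'' (cell ''k'' ''v'') (Read ''row'' (cell ''i'' ''v'')) ;;
            Write ''row'' (cell ''i'' ''v'') (Const 0))) ;;
      incr ''v'')"

text \<open>\<open>q\<close> is reset because earlier pairs were passed with respect to the old row
  \<open>i\<close> only.\<close>

definition split_row :: com where
  "split_row =
     (Assign ''v'' (Const 0) ;;
      While (Less (Reg ''v'') (Reg ''n'')) split_body ;;
      incr ''k'' ;;
      Assign ''q'' (Const 0))"

definition emit_body :: com where
  "emit_body =
     (If (Equal (Read ''row'' (cell ''i'' ''v'')) (Const 1))
        (Write ''out'' (Reg ''p'') (Reg ''v'') ;; incr ''p'')
        Skip ;;
      incr ''v'')"

text \<open>Vertices are written tentatively from \<open>pos\<close> on. A row with at most three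
  vertices leaves \<open>pos\<close> unchanged, and its entries are no part of the output.\<close>

definition emit_row :: com where
  "emit_row =
     (Assign ''v'' (Const 0) ;;
      Assign ''p'' (Reg ''pos'') ;;
      While (Less (Reg ''v'') (Reg ''n'')) emit_body ;;
      If (Less (Const 3) (Sub (Reg ''p'') (Reg ''pos'')))
        (incr ''count'' ;;
         Write ''start'' (Reg ''count'') (Reg ''p'') ;;
         Assign ''pos'' (Reg ''p''))
        Skip)"

text \<open>The number \<open>q = (d * n + y) * n + x\<close> encodes the ordered pair
  \<open>x\<close>, \<open>y\<close> and the direction \<open>d\<close>, which is 0 or 1.\<close>

definition check_pair :: com where
  "check_pair =
     (Assign ''x'' (Mod (Reg ''q'') (Reg ''n'')) ;;
      Assign ''y'' (Mod (Div (Reg ''q'') (Reg ''n'')) (Reg ''n'')) ;;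
      Assign ''base'' (Mul (Div (Reg ''q'') (Mul (Reg ''n'') (Reg ''n''))) (Reg ''n'')) ;;
      If (Conj (Neg (Equal (Reg ''x'') (Reg ''y'')))
            (Conj (Equal (Read ''row'' (cell ''i'' ''x'')) (Const 1))
              (Equal (Read ''row'' (cell ''i'' ''y'')) (Const 1))))
        (clear_marks ;;
         search ;;
         If (Less (Reg ''qt'') (Reg ''cnt'')) split_row (incr ''q''))
        (incr ''q''))"

definition main_body :: com where
  "main_body =
     If (Less (Reg ''q'') (Mul (Const 2) (Mul (Reg ''n'') (Reg ''n''))))
       check_pair
       (emit_row ;; incr ''i'' ;; Assign ''q'' (Const 0))"

definition program :: com where
  "program =
     (build_adj ;; init_row ;; While (Less (Reg ''i'') (Reg ''k'')) main_body)"

section \<open>Sets that stay strongly connected without any two of their vertices\<close>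

definition strong_on :: "'a rel \<Rightarrow> 'a set \<Rightarrow> bool" where
  "strong_on E Y \<longleftrightarrow> (\<forall>a\<in>Y. \<forall>b\<in>Y. (a, b) \<in> (Restr E Y)\<^sup>*)"

text \<open>Only deletions of exactly two vertices are demanded; by
  \<open>triconnected_minus\<close> they cover all smaller deletions, and also deletions of vertices
  outside \<open>C\<close>.\<close>

definition triconnected :: "'a rel \<Rightarrow> 'a set \<Rightarrow> bool" where
  "triconnected E C \<longleftrightarrow> 4 \<le> card C \<and> (\<forall>x\<in>C. \<forall>y\<in>C. x \<noteq> y \<longrightarrow> strong_on E (C - {x, y}))"

lemma triconnected_card: "triconnected E C \<Longrightarrow> 4 \<le> card C"
  by (simp add: triconnected_def)

lemma triconnected_finite: "triconnected E C \<Longrightarrow> finite C"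
  by (rule card_ge_0_finite) (simp add: triconnected_def)

lemma strong_on_mono: "strong_on E Y \<Longrightarrow> Restr E Y \<subseteq> E' \<Longrightarrow> strong_on E' Y"
  unfolding strong_on_def by (meson Int_subset_iff inf_le2 rtrancl_mono subsetD)

lemma strong_on_converse [simp]: "strong_on (E\<inverse>) Y \<longleftrightarrow> strong_on E Y"
proof -
  have "Restr (E\<inverse>) Y = (Restr E Y)\<inverse>" by auto
  then show ?thesis by (auto simp: strong_on_def rtrancl_converse)
qed

lemma triconnected_converse [simp]: "triconnected (E\<inverse>) C \<longleftrightarrow> triconnected E C"
  by (simp add: triconnected_def)

lemma triconnected_mono: "triconnected E C \<Longrightarrow> Restr E C \<subseteq> E' \<Longrightarrow> triconnected E' C"
  unfolding triconnected_def by (blast intro: strong_on_mono)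

lemma strong_on_if_reachable_both_ways:
  assumes "\<And>a. a \<in> Y \<Longrightarrow> (r, a) \<in> (Restr E Y)\<^sup>*" "\<And>a. a \<in> Y \<Longrightarrow> (r, a) \<in> (Restr (E\<inverse>) Y)\<^sup>*"
  shows "strong_on E Y"
proof -
  have "Restr (E\<inverse>) Y = (Restr E Y)\<inverse>" by auto
  then have "(a, r) \<in> (Restr E Y)\<^sup>*" if "a \<in> Y" for a
    using assms(2)[OF that] by (simp add: rtrancl_converse)
  then show ?thesis
    unfolding strong_on_def using assms(1) by (blast intro: rtrancl_trans)
qed

lemma triconnected_minus:
  assumes C: "triconnected E C" and X: "finite X" "card X < 3"
  shows "strong_on E (C - X)"
  unfolding strong_on_def
proof (intro ballI)
  fix a b assume a: "a \<in> C - X" and b: "b \<in> C - X"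
  show "(a, b) \<in> (Restr E (C - X))\<^sup>*"
  proof (cases "a = b")
    case False
    have "card (C - {a, b}) \<ge> 2"
      using triconnected_card[OF C] triconnected_finite[OF C] a b False by (simp add: card_Diff_subset)
    moreover have "card (X \<inter> C) \<le> 2"
      using X card_mono[of X "X \<inter> C"] by simp
    \<comment> \<open>Besides \<open>a\<close> and \<open>b\<close> the set \<open>C\<close> has two
      further vertices, so the deleted set can be enlarged to exactly two vertices that avoid
      \<open>a\<close> and \<open>b\<close>. A path that survives the larger deletion also survives
      the smaller one.\<close>
    ultimately obtain Z where Z: "X \<inter> C \<subseteq> Z" "Z \<subseteq> C - {a, b}" "card Z = 2"
      using exists_subset_between[of "X \<inter> C" 2 "C - {a, b}"] a b triconnected_finite[OF C] by blast
    then obtain x y where "Z = {x, y}" "x \<noteq> y"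
      by (auto simp: card_2_iff)
    with C Z a b have "(a, b) \<in> (Restr E (C - Z))\<^sup>*"
      unfolding triconnected_def strong_on_def by auto
    moreover have "Restr E (C - Z) \<subseteq> Restr E (C - X)" using Z by auto
    ultimately show ?thesis using rtrancl_mono by blast
  qed simp
qed

text \<open>Every vertex reaches some other vertex of \<open>C\<close> and so has an outgoing arc.
  This justifies starting with the tails, whose number is bounded by \<open>m\<close> as well as by
  \<open>n\<close>.\<close>

lemma triconnected_subset_tails: "triconnected E C \<Longrightarrow> C \<subseteq> fst ` E"
proof
  fix a assume C: "triconnected E C" and a: "a \<in> C"
  have "card (C - {a}) \<ge> 3"
    using triconnected_card[OF C] triconnected_finite[OF C] a by simp
  then obtain b where b: "b \<in> C" "b \<noteq> a"
    by (metis Diff_iff card.empty ex_in_conv insertCI not_numeral_le_zero)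
  have "(a, b) \<in> (Restr E (C - {}))\<^sup>*"
    using triconnected_minus[OF C, of "{}"] a b by (auto simp: strong_on_def)
  then obtain c where "(a, c) \<in> E"
    using b by (auto elim: converse_rtranclE)
  then show "a \<in> fst ` E" by force
qed

lemma closed_rtrancl: "(a, b) \<in> R\<^sup>* \<Longrightarrow> a \<in> S \<Longrightarrow> R `` S \<subseteq> S \<Longrightarrow> b \<in> S"
  by (induction rule: rtrancl_induct) auto

text \<open>If \<open>C\<close> had vertices on both sides, a path inside \<open>C - {x, y}\<close>
  would lead from \<open>S\<close> to the other side, but no arc of \<open>U - {x, y}\<close> leaves
  \<open>S\<close>.\<close>

lemma triconnected_separation:
  assumes C: "triconnected E C" "C \<subseteq> U" and S: "E `` S \<inter> (U - {x, y}) \<subseteq> S" "S \<subseteq> U - {x, y}"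
  shows "C \<subseteq> insert x (insert y S) \<or> C \<subseteq> U - S"
proof (rule ccontr)
  assume "\<not> ?thesis"
  then obtain a b where a: "a \<in> C - {x, y}" "a \<notin> S" and b: "b \<in> C - {x, y}" "b \<in> S"
    using C(2) S(2) by blast
  \<comment> \<open>\<open>x\<close> and \<open>y\<close> need not lie in \<open>C\<close>, hence
    the general form of deletion in \<open>triconnected_minus\<close>.\<close>
  have "strong_on E (C - {x, y})"
    using card_2_iff' by (intro triconnected_minus C) (auto simp: card_insert_if)
  then have "(b, a) \<in> (Restr E (C - {x, y}))\<^sup>*" using a b by (simp add: strong_on_def)
  then have "a \<in> S"
    using b(2) by (rule closed_rtrancl) (use S(1) C(2) in blast)
  with a show False by simp
qed

text \<open>
  The third clause makes the \<open>triconnected\<close> members of the family maximal, the last one bounds the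
  number of splittings: splitting a member at two vertices decreases the sum.
\<close>

definition family :: "'a rel \<Rightarrow> (nat \<Rightarrow> 'a set) \<Rightarrow> nat \<Rightarrow> bool" where
  "family E R k \<longleftrightarrow>
     (\<forall>j<k. R j \<subseteq> fst ` E) \<and>
     (\<forall>C. triconnected E C \<longrightarrow> (\<exists>j<k. C \<subseteq> R j)) \<and>
     (\<forall>j<k. \<forall>l<k. j \<noteq> l \<longrightarrow> card (R j \<inter> R l) \<le> 2) \<and>
     k + (\<Sum>j<k. card (R j) - 3) \<le> 1 + (card (fst ` E) - 3)"

lemma family_init: "R 0 = fst ` E \<Longrightarrow> family E R 1"
  by (auto simp: family_def triconnected_subset_tails)

text \<open>Coverage is \<open>triconnected_separation\<close>, applied to \<open>E\<close> or its
  converse. The two parts meet only in \<open>x\<close> and \<open>y\<close>, and every other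
  intersection is contained in an old one, so the overlap bound persists.\<close>

lemma family_split:
  assumes fam: "family E R k" and fin: "finite E" and i: "i < k"
    and xy: "x \<in> R i" "y \<in> R i" "x \<noteq> y"
    and S: "S \<subset> R i - {x, y}" "S \<noteq> {}" and D: "D = E \<or> D = E\<inverse>"
    and closed: "D `` S \<inter> (R i - {x, y}) \<subseteq> S"
  defines "R' \<equiv> R(i := insert x (insert y S), k := R i - S)"
  shows "family E R' (Suc k)"
    and "Suc (\<Sum>j<Suc k. card (R' j) - 3) \<le> (\<Sum>j<k. card (R j) - 3)"
proof -
  let ?T = "fst ` E"
  have finT: "finite ?T" using fin by simp
  have R: "R j \<subseteq> ?T" if "j < k" for j using fam that by (simp add: family_def)
  have finR: "finite (R j)" if "j < k" for j using R[OF that] finT by (rule finite_subset)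
  have finS: "finite S" using S(1) finR[OF i] by (meson finite_Diff finite_subset psubset_imp_subset)
  have ne: "i \<noteq> k" using i by simp
  have R'i: "R' i = insert x (insert y S)" and R'k: "R' k = R i - S"
    and R'j: "\<And>j. j \<noteq> i \<Longrightarrow> j \<noteq> k \<Longrightarrow> R' j = R j"
    using ne by (auto simp: R'_def)
  have sub: "R' i \<subseteq> R i" "R' k \<subseteq> R i"
    using S(1) xy by (auto simp: R'i R'k)
  have ci: "card (R' i) = card S + 2"
    using S(1) xy(3) finS by (simp add: R'i card_insert_if) blast
  have ck: "card (R' k) = card (R i) - card S"
    using finS S(1) by (simp add: R'k card_Diff_subset subset_eq psubset_eq)
  have "card S < card (R i - {x, y})" using S(1) finR[OF i] by (simp add: psubset_card_mono)
  also have "card (R i - {x, y}) = card (R i) - 2"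
    using xy finR[OF i] by (simp add: card_Diff_subset)
  finally have lt: "card S < card (R i) - 2" .
  have pos: "card S > 0" using S(2) finS by (simp add: card_gt_0_iff)
  have "(\<Sum>j<Suc k. card (R' j) - 3) = (\<Sum>j<k. card (R' j) - 3) + (card (R' k) - 3)" by simp
  also have "(\<Sum>j<k. card (R' j) - 3) = (card (R' i) - 3) + (\<Sum>j\<in>{..<k} - {i}. card (R' j) - 3)"
    using i by (simp add: sum.remove)
  also have "(\<Sum>j\<in>{..<k} - {i}. card (R' j) - 3) = (\<Sum>j\<in>{..<k} - {i}. card (R j) - 3)"
    by (rule sum.cong) (auto simp: R'j)
  \<comment> \<open>\<open>lt\<close> and \<open>pos\<close> say \<open>1 \<le> card S\<close> and
    \<open>card S + 3 \<le> card (R i)\<close>; hence no difference is truncated and the two new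
    summands add up to \<open>card (R i) - 4\<close>.\<close>
  finally have "Suc (\<Sum>j<Suc k. card (R' j) - 3) \<le> (card (R i) - 3) + (\<Sum>j\<in>{..<k} - {i}. card (R j) - 3)"
    using lt pos unfolding ci ck by linarith
  also have "\<dots> = (\<Sum>j<k. card (R j) - 3)"
    using i by (simp add: sum.remove)
  finally show dec: "Suc (\<Sum>j<Suc k. card (R' j) - 3) \<le> (\<Sum>j<k. card (R j) - 3)" .
  have inter: "card (R' j \<inter> R' l) \<le> 2" if "j < l" "l < Suc k" for j l
  proof -
    have old: "card (R j \<inter> R l) \<le> 2" if "j < k" "l < k" "j \<noteq> l" for j l
      using fam that by (simp add: family_def)
    have mono: "card (P \<inter> Q) \<le> 2" if "P \<subseteq> R p" "Q \<subseteq> R q" "p < k" "q < k" "p \<noteq> q" for P Q p q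
    proof -
      have "card (P \<inter> Q) \<le> card (R p \<inter> R q)"
        using that finR by (intro card_mono) auto
      with old[OF that(3,4,5)] show ?thesis by simp
    qed
    show ?thesis
    proof (cases "l = k")
      case True
      show ?thesis
      proof (cases "j = i")
        case True
        have "R' j \<inter> R' l \<subseteq> {x, y}"
          using True \<open>l = k\<close> by (auto simp: R'i R'k)
        then have "card (R' j \<inter> R' l) \<le> card {x, y}" by (intro card_mono) auto
        then show ?thesis using xy(3) by simp
      next
        case False
        then show ?thesis
          using mono[of "R' j" j "R' l" i] sub i that \<open>l = k\<close> by (auto simp: R'j)
      qed
    next
      case False
      then have "R' j \<subseteq> R j" "R' l \<subseteq> R l"
        using that sub(1) by (cases "j = i"; cases "l = i"; auto simp: R'j)+
      then show ?thesis using mono[of "R' j" j "R' l" l] that False by auto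
    qed
  qed
  have cover: "\<exists>j<Suc k. C \<subseteq> R' j" if C: "triconnected E C" for C
  proof -
    obtain j where j: "j < k" "C \<subseteq> R j" using fam C by (auto simp: family_def)
    show ?thesis
    proof (cases "j = i")
      case True
      have "triconnected D C" using D C by auto
      from triconnected_separation[OF this, of "R i" S x y] j(2) True closed S(1)
      have "C \<subseteq> R' i \<or> C \<subseteq> R' k"
        by (auto simp: R'i R'k)
      with i show ?thesis by (meson less_Suc_eq)
    next
      case False
      with j show ?thesis by (metis R'j less_Suc_eq nat_neq_iff)
    qed
  qed
  have rng: "R' j \<subseteq> ?T" if "j < Suc k" for j
    using that R[of j] R[OF i] sub R'j[of j] by (cases "j = k \<or> j = i") auto
  have "card (R' j \<inter> R' l) \<le> 2" if "j < Suc k" "l < Suc k" "j \<noteq> l" for j l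
    using inter[of j l] inter[of l j] that by (cases j l rule: linorder_cases) (auto simp: Int_commute)
  moreover have "Suc k + (\<Sum>j<Suc k. card (R' j) - 3) \<le> 1 + (card ?T - 3)"
    using dec fam by (simp add: family_def)
  ultimately show "family E R' (Suc k)"
    unfolding family_def using rng cover by blast
qed

definition maximal_triconnected :: "'a rel \<Rightarrow> 'a set set" where
  "maximal_triconnected E = {C. triconnected E C \<and> (\<forall>C'. triconnected E C' \<longrightarrow> C \<subseteq> C' \<longrightarrow> C' = C)}"

text \<open>Any triconnected superset of a large member \<open>R j\<close> lies in some
  \<open>R l\<close>, and the overlap bound forces \<open>l = j\<close>. Conversely, a maximal set
  lies in some member, which is then large, hence triconnected, hence equal to it.\<close>

lemma family_final:
  assumes fam: "family E R k" and fin: "finite E"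
    and triconnected: "\<And>j. j < k \<Longrightarrow> 4 \<le> card (R j) \<Longrightarrow> triconnected E (R j)"
  shows "R ` {j. j < k \<and> 4 \<le> card (R j)} = maximal_triconnected E"
    and "inj_on R {j. j < k \<and> 4 \<le> card (R j)}"
proof -
  have finR: "finite (R j)" if "j < k" for j
    using fam fin that by (meson family_def finite_imageI finite_subset)
  have eq: "j = l" if "j < k" "l < k" "4 \<le> card (R j)" "R j \<subseteq> R l" for j l
  proof (rule ccontr)
    assume "j \<noteq> l"
    then have "card (R j \<inter> R l) \<le> 2" using fam that by (simp add: family_def)
    with that show False by (simp add: Int_absorb2)
  qed
  then show "inj_on R {j. j < k \<and> 4 \<le> card (R j)}"
    by (auto simp: inj_on_def)
  have cover: "\<exists>j<k. C \<subseteq> R j" if "triconnected E C" for C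
    using fam that by (auto simp: family_def)
  show "R ` {j. j < k \<and> 4 \<le> card (R j)} = maximal_triconnected E"
  proof (intro equalityI subsetI)
    fix C assume "C \<in> R ` {j. j < k \<and> 4 \<le> card (R j)}"
    then obtain j where j: "j < k" "4 \<le> card (R j)" "C = R j" by auto
    have "C' = C" if C': "triconnected E C'" "C \<subseteq> C'" for C'
    proof -
      obtain l where "l < k" "C' \<subseteq> R l" using cover[OF C'(1)] by auto
      with eq[of j l] j C' show ?thesis by auto
    qed
    with j triconnected show "C \<in> maximal_triconnected E" by (auto simp: maximal_triconnected_def)
  next
    fix C assume C: "C \<in> maximal_triconnected E"
    then have t: "triconnected E C" and mx: "\<And>C'. triconnected E C' \<Longrightarrow> C \<subseteq> C' \<Longrightarrow> C' = C"
      by (auto simp: maximal_triconnected_def)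
    obtain j where j: "j < k" "C \<subseteq> R j" using cover[OF t] by auto
    have "4 \<le> card (R j)" using triconnected_card[OF t] card_mono[OF finR[OF j(1)] j(2)] by simp
    with j triconnected mx show "C \<in> R ` {j. j < k \<and> 4 \<le> card (R j)}" by blast
  qed
qed

section \<open>From vertex-connected components to relations\<close>

lemma rtrancl_image:
  "(a, b) \<in> R\<^sup>* \<Longrightarrow> (f a, f b) \<in> (map_prod f f ` R)\<^sup>*"
  by (induction rule: rtrancl_induct) (auto intro: rtrancl_into_rtrancl)

lemma Restr_image:
  "inj_on f V \<Longrightarrow> E \<subseteq> V \<times> V \<Longrightarrow> Y \<subseteq> V \<Longrightarrow>
    Restr (map_prod f f ` E) (f ` Y) = map_prod f f ` Restr E Y"
  by (fastforce simp: inj_on_def)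

lemma strong_on_image:
  assumes "strong_on E Y" "inj_on f V" "E \<subseteq> V \<times> V" "Y \<subseteq> V"
  shows "strong_on (map_prod f f ` E) (f ` Y)"
  using assms(1) unfolding strong_on_def Restr_image[OF assms(2-4)] by (auto intro: rtrancl_image)

lemma triconnected_image:
  assumes t: "triconnected E C" and inj: "inj_on f V" and E: "E \<subseteq> V \<times> V" and C: "C \<subseteq> V"
  shows "triconnected (map_prod f f ` E) (f ` C)"
proof -
  have "card (f ` C) = card C" using inj C by (meson card_image inj_on_subset)
  moreover have "strong_on (map_prod f f ` E) (f ` C - {f x, f y})" if "x \<in> C" "y \<in> C" "x \<noteq> y" for x y
  proof -
    have "f ` C - {f x, f y} = f ` (C - {x, y})"
      using inj C that by (auto simp: inj_on_def subset_iff)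
    moreover have "strong_on E (C - {x, y})" using t that by (simp add: triconnected_def)
    ultimately show ?thesis using strong_on_image[OF _ inj E, of "C - {x, y}"] C by auto
  qed
  ultimately show ?thesis using t by (auto simp: triconnected_def)
qed

text \<open>The program computes with vertex numbers; this transports its result to the vertices.
  Both \<open>f\<close> and its inverse preserve triconnected sets and inclusions, hence also
  maximality.\<close>

lemma maximal_triconnected_image:
  assumes inj: "inj_on f V" and E: "E \<subseteq> V \<times> V"
  shows "maximal_triconnected (map_prod f f ` E) = (\<lambda>C. f ` C) ` maximal_triconnected E"
proof -
  let ?g = "the_inv_into V f" and ?E = "map_prod f f ` E"
  have gf: "?g (f v) = v" if "v \<in> V" for v using inj that by (rule the_inv_into_f_f)
  have inv: "map_prod ?g ?g ` ?E = E"
    using E by (force simp: image_image gf)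
  have injg: "inj_on ?g (f ` V)" using inj by (rule inj_on_the_inv_into)
  have E': "?E \<subseteq> f ` V \<times> f ` V" using E by auto
  have sub: "C \<subseteq> V" if "triconnected E C" for C using triconnected_subset_tails[OF that] E by force
  have sub': "C \<subseteq> f ` V" if "triconnected ?E C" for C using triconnected_subset_tails[OF that] E by force
  have push: "triconnected ?E (f ` C)" if "triconnected E C" for C using triconnected_image[OF that inj E sub[OF that]] .
  have pull: "triconnected E (?g ` C)" if "triconnected ?E C" for C
    using triconnected_image[OF that injg E' sub'[OF that]] by (simp add: inv)
  have fg: "f ` ?g ` C = C" if t: "triconnected ?E C" for C
  proof -
    have "f (?g c) = c" if "c \<in> C" for c
      using sub'[OF t] that f_the_inv_into_f[OF inj] by auto
    then show ?thesis by (simp add: image_image)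
  qed
  have gf': "?g ` f ` C = C" if t: "triconnected E C" for C
  proof -
    have "?g (f c) = c" if "c \<in> C" for c
      using sub[OF t] that gf by auto
    then show ?thesis by (simp add: image_image)
  qed
  show ?thesis
  proof (intro equalityI subsetI)
    fix C assume "C \<in> maximal_triconnected ?E"
    then have C: "triconnected ?E C" and mx: "\<And>C'. triconnected ?E C' \<Longrightarrow> C \<subseteq> C' \<Longrightarrow> C' = C"
      by (auto simp: maximal_triconnected_def)
    have "?g ` C \<in> maximal_triconnected E"
      unfolding maximal_triconnected_def
    proof (intro CollectI conjI allI impI pull C)
      fix C' assume C': "triconnected E C'" "?g ` C \<subseteq> C'"
      have "f ` C' = C" using mx[OF push[OF C'(1)]] image_mono[OF C'(2), of f] fg[OF C] by simp
      then show "C' = ?g ` C" using gf'[OF C'(1)] by simp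
    qed
    with fg[OF C] show "C \<in> (\<lambda>C. f ` C) ` maximal_triconnected E" by (metis image_eqI)
  next
    fix D assume "D \<in> (\<lambda>C. f ` C) ` maximal_triconnected E"
    then obtain C where C: "triconnected E C" and mx: "\<And>C'. triconnected E C' \<Longrightarrow> C \<subseteq> C' \<Longrightarrow> C' = C" and D: "D = f ` C"
      by (auto simp: maximal_triconnected_def)
    show "D \<in> maximal_triconnected ?E"
      unfolding maximal_triconnected_def D
    proof (intro CollectI conjI allI impI push C)
      fix C' assume C': "triconnected ?E C'" "f ` C \<subseteq> C'"
      have "?g ` C' = C" using mx[OF pull[OF C'(1)]] image_mono[OF C'(2), of ?g] gf'[OF C] by simp
      then show "C' = f ` C" using fg[OF C'(1)] by simp
    qed
  qed
qed

lemma rtrancl_on_Restr: "(a, b) \<in> rtrancl_on Y (Restr E Y) \<longleftrightarrow> a \<in> Y \<and> (a, b) \<in> (Restr E Y)\<^sup>*"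
proof
  assume "(a, b) \<in> rtrancl_on Y (Restr E Y)"
  then show "a \<in> Y \<and> (a, b) \<in> (Restr E Y)\<^sup>*"
    by (meson in_rtrancl_on_in_F(1) rtrancl_on_rtranclI)
next
  assume "a \<in> Y \<and> (a, b) \<in> (Restr E Y)\<^sup>*"
  then have "(a, b) \<in> (Restr E Y)\<^sup>*" "a \<in> Y" by auto
  then show "(a, b) \<in> rtrancl_on Y (Restr E Y)"
    by (induction rule: rtrancl_induct) (auto intro: rtrancl_on_into_rtrancl_on)
qed

lemma arcs_ends_induce: "arcs_ends (G \<restriction> Y) = Restr (arcs_ends G) Y"
  by (auto simp: arcs_ends_def arc_to_ends_def)

lemma strongly_connected_induce: "strongly_connected (G \<restriction> Y) \<longleftrightarrow> Y \<noteq> {} \<and> strong_on (arcs_ends G) Y"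
  by (auto simp: strongly_connected_def reachable_def arcs_ends_induce rtrancl_on_Restr strong_on_def)

text \<open>The nonemptiness required by \<open>strongly_connected\<close> holds because the deleted
  set is a proper subset of the vertices; for a pair this follows from there being at least four
  vertices.\<close>

lemma k_vertex_connected_3_iff_triconnected: "k_vertex_connected 3 G \<longleftrightarrow> triconnected (arcs_ends G) (verts G)"
proof
  assume G: "k_vertex_connected 3 G"
  then have c: "4 \<le> card (verts G)" by (simp add: k_vertex_connected_def)
  have "strong_on (arcs_ends G) (verts G - {x, y})" if "x \<in> verts G" "y \<in> verts G" for x y
  proof -
    have "card {x, y} \<le> 2" by (simp add: card_insert_if)
    with c that have "{x, y} \<subset> verts G" "card {x, y} < 3" by auto
    with G have "strongly_connected (G \<restriction> (verts G - {x, y}))"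
      unfolding k_vertex_connected_def by blast
    then show ?thesis by (simp add: strongly_connected_induce)
  qed
  with c show "triconnected (arcs_ends G) (verts G)" by (simp add: triconnected_def)
next
  assume t: "triconnected (arcs_ends G) (verts G)"
  have "strongly_connected (G \<restriction> (verts G - X))" if "X \<subset> verts G" "card X < 3" for X
    using that triconnected_minus[OF t _ that(2)] triconnected_finite[OF t]
    by (auto simp: strongly_connected_induce dest: finite_subset)
  with triconnected_card[OF t] show "k_vertex_connected 3 G" by (simp add: k_vertex_connected_def)
qed

text \<open>Maximality among all subgraphs becomes maximality of vertex sets, since additional arcs
  preserve triconnectedness. A maximal subgraph \<open>H\<close> lies below the induced subgraph of
  any larger triconnected set and thus equals it; a triconnected subgraph above the induced subgraph
  of a maximal set can gain neither vertices nor arcs.\<close>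

lemma (in wf_digraph) vertex_connected_components_3:
  "vertex_connected_components 3 G = maximal_triconnected (arcs_ends G)"
proof -
  let ?E = "arcs_ends G"
  have ind: "subgraph (G \<restriction> C) G" if "C \<subseteq> verts G" for C
    using that by (simp add: subgraph_induce_subgraphI)
  have ends: "arcs_ends H \<subseteq> Restr ?E (verts H)" if "subgraph H G" for H
  proof -
    interpret H: wf_digraph H using that by (rule subgraphE)
    have "tail H = tail G" "head H = head G" "arcs H \<subseteq> arcs G"
      using that by (auto simp: subgraph_def compatible_def)
    then show ?thesis
      using H.tail_in_verts H.head_in_verts by (auto simp: arcs_ends_def arc_to_ends_def)
  qed
  have triconnected_ind: "triconnected (arcs_ends (G \<restriction> C)) C" if "triconnected ?E C" for C
    using that unfolding arcs_ends_induce by (rule triconnected_mono) auto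
  have sub: "C \<subseteq> verts G" if "triconnected ?E C" for C
    using triconnected_subset_tails[OF that] by (auto simp: arcs_ends_def arc_to_ends_def)
  have triconnected_sub: "triconnected ?E (verts H)" if "subgraph H G" "triconnected (arcs_ends H) (verts H)" for H
    using that(2) by (rule triconnected_mono) (use ends[OF that(1)] in auto)
  show ?thesis
  proof (intro equalityI subsetI)
    fix C assume "C \<in> vertex_connected_components 3 G"
    then obtain H where H: "subgraph H G" "triconnected (arcs_ends H) (verts H)" "C = verts H"
      and mx: "\<And>H'. H' \<noteq> H \<Longrightarrow> subgraph H H' \<Longrightarrow> subgraph H' G \<Longrightarrow> \<not> triconnected (arcs_ends H') (verts H')"
      by (auto simp: vertex_connected_components_def pre_digraph.max_subgraph_def
          k_vertex_connected_3_iff_triconnected)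
    have "C' = C" if C': "triconnected ?E C'" "C \<subseteq> C'" for C'
    proof -
      have "subgraph H (G \<restriction> C')"
        using H(1,3) C'(2) ind[OF sub[OF C'(1)]] ends[OF H(1)] wellformed
        by (auto simp: subgraph_def compatible_def dest: wf_digraph.tail_in_verts wf_digraph.head_in_verts)
      then have "G \<restriction> C' = H"
        using mx[of "G \<restriction> C'"] ind[OF sub[OF C'(1)]] triconnected_ind[OF C'(1)] by auto
      then show ?thesis using H(3) by auto
    qed
    with triconnected_sub[OF H(1,2)] H(3) show "C \<in> maximal_triconnected ?E" by (simp add: maximal_triconnected_def)
  next
    fix C assume "C \<in> maximal_triconnected ?E"
    then have C: "triconnected ?E C" and mx: "\<And>C'. triconnected ?E C' \<Longrightarrow> C \<subseteq> C' \<Longrightarrow> C' = C"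
      by (auto simp: maximal_triconnected_def)
    have "H = G \<restriction> C" if H: "subgraph (G \<restriction> C) H" "subgraph H G" "triconnected (arcs_ends H) (verts H)" for H
    proof -
      have v: "verts H = C"
        using mx[OF triconnected_sub[OF H(2,3)]] H(1) by (auto simp: subgraph_def)
      moreover have "arcs H = {e \<in> arcs G. tail G e \<in> C \<and> head G e \<in> C}"
      proof
        show "{e \<in> arcs G. tail G e \<in> C \<and> head G e \<in> C} \<subseteq> arcs H"
          using H(1) by (auto simp: subgraph_def)
        show "arcs H \<subseteq> {e \<in> arcs G. tail G e \<in> C \<and> head G e \<in> C}"
          using H(2) v by (auto simp: subgraph_def compatible_def
              dest: wf_digraph.tail_in_verts wf_digraph.head_in_verts)
      qed
      moreover have "tail H = tail G" "head H = head G"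
        using H(2) by (auto simp: subgraph_def compatible_def)
      ultimately show ?thesis by (simp add: induce_subgraph_def)
    qed
    then have "max_subgraph (k_vertex_connected 3) (G \<restriction> C)"
      unfolding max_subgraph_def k_vertex_connected_3_iff_triconnected
      using ind[OF sub[OF C]] triconnected_ind[OF C] by auto
    then show "C \<in> vertex_connected_components 3 G"
      unfolding vertex_connected_components_def by force
  qed
qed

section \<open>Correctness of the program\<close>

lemma upt_Suc_Int_neq: "a \<le> c \<Longrightarrow> {a..<Suc c} \<inter> {x. x \<noteq> c} = {a..<c}"
  by auto

text \<open>Words must hold quadratic numbers: cell indices of \<open>row\<close> reach up to
  \<open>(n + 1) * n + n\<close>, and \<open>q\<close> runs up to \<open>2 * (n * n)\<close>. The
  generous constant makes the overflow checks linear consequences of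
  \<open>W_bounds\<close>.\<close>

locale arc_list =
  fixes es :: "(nat \<times> nat) list" and n W :: nat
  assumes range: "set es \<subseteq> {..<n} \<times> {..<n}"
    and W_ge: "4 * (n + length es + 2) * (n + length es + 2) \<le> W"
begin

abbreviation "m \<equiv> length es"
abbreviation "E \<equiv> set es"

lemma W_bounds:
  "4 * n * n + 4 * m * m + 8 * n * m + 16 * n + 16 * m + 16 \<le> W"
  using W_ge by (simp add: algebra_simps)

lemma ends_less: "e < m \<Longrightarrow> fst (es ! e) < n" "e < m \<Longrightarrow> snd (es ! e) < n"
  using subsetD[OF range nth_mem, of e] by (auto simp: mem_Times_iff)

section \<open>Construction of the adjacency lists and of the initial vertex set\<close>

definition graph_input :: "state \<Rightarrow> bool" where
  "graph_input s \<longleftrightarrow> reg s ''n'' = n \<and> reg s ''m'' = m \<and>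
     (\<forall>e<m. arr s ''tail'' e = fst (es ! e) \<and> arr s ''head'' e = snd (es ! e))"

text \<open>The second argument is the progress of the scan in \<open>arc_body\<close>. By
  \<open>nbrs_eq\<close>, \<open>nbrs p m\<close> consists of the out-neighbours of \<open>p\<close>
  if \<open>p < n\<close>, and of the in-neighbours of \<open>p - n\<close> otherwise.\<close>

definition nbrs :: "nat \<Rightarrow> nat \<Rightarrow> nat set" where
  "nbrs p e = {b. \<exists>e'<e. fst (es ! e') = p \<and> b = snd (es ! e') \<or> snd (es ! e') + n = p \<and> b = fst (es ! e')}"

definition ndeg :: "nat \<Rightarrow> nat \<Rightarrow> nat" where
  "ndeg p e = (\<Sum>e'<e. (if fst (es ! e') = p then 1 else 0) + (if snd (es ! e') + n = p then 1 else 0))"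

definition adj_start :: "nat \<Rightarrow> nat" where
  "adj_start p = (\<Sum>p'<p. ndeg p' m)"

lemma nbrs_Suc: "nbrs p (Suc e) =
    (if fst (es ! e) = p then {snd (es ! e)} else {}) \<union>
    (if snd (es ! e) + n = p then {fst (es ! e)} else {}) \<union> nbrs p e"
  by (auto simp: nbrs_def less_Suc_eq)

lemma ndeg_Suc: "ndeg p (Suc e) =
    ndeg p e + (if fst (es ! e) = p then 1 else 0) + (if snd (es ! e) + n = p then 1 else 0)"
  by (simp add: ndeg_def)

lemma nbrs_0 [simp]: "nbrs p 0 = {}" and ndeg_0 [simp]: "ndeg p 0 = 0"
  by (simp_all add: nbrs_def ndeg_def)

lemma nbrs_eq: "p < 2 * n \<Longrightarrow> nbrs p m = (if p < n then E `` {p} else E\<inverse> `` {p - n})"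
proof -
  have mem: "(a, b) \<in> E \<longleftrightarrow> (\<exists>e<m. fst (es ! e) = a \<and> snd (es ! e) = b)" for a b
    by (simp add: in_set_conv_nth prod_eq_iff)
  have "snd (es ! e) + n = p \<longleftrightarrow> \<not> p < n \<and> snd (es ! e) = p - n" for e
    by auto
  then show ?thesis
    using ends_less by (auto simp: nbrs_def mem)
qed

lemma ndeg_le: "ndeg p e \<le> 2 * e"
  by (induction e) (simp_all add: ndeg_Suc)

lemma adj_start_Suc: "adj_start (Suc p) = adj_start p + ndeg p m"
  by (simp add: adj_start_def)

lemma adj_start_mono: "p \<le> p' \<Longrightarrow> adj_start p \<le> adj_start p'"
  unfolding adj_start_def by (intro sum_mono2) auto

text \<open>Double counting: every arc has at most one entry at the node of its tail and one at the
  node of its head.\<close>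

lemma adj_start_le: "adj_start p \<le> 2 * m"
proof -
  have "adj_start p = (\<Sum>e<m. \<Sum>p'<p. (if fst (es ! e) = p' then 1 else 0) + (if snd (es ! e) + n = p' then 1 else 0))"
    unfolding adj_start_def ndeg_def by (rule sum.swap)
  also have "\<dots> \<le> (\<Sum>e<m. 2)"
    by (intro sum_mono) (simp add: sum.distrib sum.delta)
  finally show ?thesis by simp
qed

definition adj_lists :: "state \<Rightarrow> bool" where
  "adj_lists s \<longleftrightarrow> (\<forall>p\<le>2 * n. arr s ''off'' p = adj_start p) \<and>
     (\<forall>p<2 * n. arr s ''adj'' ` {adj_start p..<adj_start (Suc p)} = nbrs p m)"

lemma wp_arcs:
  assumes g: "graph_input s0" and p: "reg s0 ''p'' < 2 * n" and c: "reg s0 ''c'' \<le> 2 * m"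
    and e: "reg s0 ''e'' = 0"
  shows "wp W (While (Less (Reg ''e'') (Reg ''m'')) arc_body)
    (\<lambda>s t. reg s ''c'' = reg s0 ''c'' + ndeg (reg s0 ''p'') m \<and>
       arr s ''adj'' ` {reg s0 ''c''..<reg s ''c''} = nbrs (reg s0 ''p'') m \<and>
       (\<forall>i<reg s0 ''c''. arr s ''adj'' i = arr s0 ''adj'' i) \<and> t \<le> t0 + 50 * m + 10) s0 t0"
proof -
  define I where "I = (\<lambda>(s :: state) t. reg s ''e'' \<le> m \<and>
       reg s ''c'' = reg s0 ''c'' + ndeg (reg s0 ''p'') (reg s ''e'') \<and>
       arr s ''adj'' ` {reg s0 ''c''..<reg s ''c''} = nbrs (reg s0 ''p'') (reg s ''e'') \<and>
       (\<forall>i<reg s0 ''c''. arr s ''adj'' i = arr s0 ''adj'' i) \<and> t \<le> t0 + 50 * reg s ''e'')"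
  show ?thesis
  proof (rule wp_While[where I = I and B = "t0 + 50 * m"])
    show "I s0 t0" by (simp add: I_def e)
  next
    fix s t assume I: "I s t" and fr: "same arc_body s0 s"
    have [simp]: "reg s ''n'' = n" "reg s ''m'' = m" "arr s ''tail'' = arr s0 ''tail''"
        "arr s ''head'' = arr s0 ''head''" "reg s ''p'' = reg s0 ''p''"
      using fr g by (auto simp: same_def arc_body_def graph_input_def)
    have tl [simp]: "e < m \<Longrightarrow> arr s0 ''tail'' e = fst (es ! e) \<and> arr s0 ''head'' e = snd (es ! e)" for e
      using g by (simp add: graph_input_def)
    show "t \<le> t0 + 50 * m \<and> fits_test W (Less (Reg ''e'') (Reg ''m'')) s"
      using I W_bounds by (auto simp: I_def)
    {
      assume "eval_test (Less (Reg ''e'') (Reg ''m'')) s"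
      then have e: "reg s ''e'' < m" by simp
      have b: "reg s ''c'' \<le> 4 * m"
        using I c ndeg_le[of "reg s0 ''p''" "reg s ''e''"] e by (simp add: I_def)
      note ends_less[OF e]
      then show "wp W arc_body I s (t + (1 + cost_test (Less (Reg ''e'') (Reg ''m''))))"
        using I[unfolded I_def, THEN conjunct1] I[unfolded I_def, THEN conjunct2, THEN conjunct1]
          I[unfolded I_def, THEN conjunct2, THEN conjunct2] W_bounds b e p
        by (simp add: arc_body_def I_def ndeg_Suc nbrs_Suc upt_Suc_Int_neq)
    }
    {
      assume "\<not> eval_test (Less (Reg ''e'') (Reg ''m'')) s"
      then have "reg s ''e'' = m" using I by (simp add: I_def)
      then show "reg s ''c'' = reg s0 ''c'' + ndeg (reg s0 ''p'') m \<and>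
       arr s ''adj'' ` {reg s0 ''c''..<reg s ''c''} = nbrs (reg s0 ''p'') m \<and>
       (\<forall>i<reg s0 ''c''. arr s ''adj'' i = arr s0 ''adj'' i) \<and> 
       t + (1 + cost_test (Less (Reg ''e'') (Reg ''m''))) \<le> t0 + 50 * m + 10"
        using I by (auto simp: I_def)
    }
  qed
qed

lemma wp_build_adj:
  assumes g: "graph_input s0"
  shows "wp W build_adj (\<lambda>s t. adj_lists s \<and> t \<le> t0 + 100 * (m + 1) * (2 * n + 1)) s0 t0"
proof -
  define I where "I = (\<lambda>(s :: state) t. reg s ''p'' \<le> 2 * n \<and> reg s ''c'' = adj_start (reg s ''p'') \<and>
       (\<forall>p<reg s ''p''. arr s ''off'' p = adj_start p \<and> arr s ''adj'' ` {adj_start p..<adj_start (Suc p)} = nbrs p m) \<and>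
       t \<le> t0 + 10 + 100 * (m + 1) * reg s ''p'')"
  have adj_start: "adj_start p \<le> W" "p \<le> 2 * n \<Longrightarrow> p \<le> W" for p
    using adj_start_le[of p] W_bounds by simp_all
  have "wp W (While (Less (Reg ''p'') (Add (Reg ''n'') (Reg ''n''))) node_body)
     (wp W (Write ''off'' (Reg ''p'') (Reg ''c''))
        (\<lambda>s t. adj_lists s \<and> t \<le> t0 + 100 * (m + 1) * (2 * n + 1)))
     (set_reg ''p'' 0 (set_reg ''c'' 0 s0)) (t0 + 4)"
  proof (rule wp_While[where I = I and B = "t0 + 10 + 100 * (m + 1) * (2 * n)"], goal_cases)
    case 1
    show ?case by (simp add: I_def adj_start_def)
  next
    case (2 s t)
    note I = 2(1) and fr = 2(2)
    have "100 * (m + 1) * reg s ''p'' \<le> 100 * (m + 1) * (2 * n)"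
      using I unfolding I_def by (intro mult_left_mono) auto
    then have "t \<le> t0 + 10 + 100 * (m + 1) * (2 * n)"
      using I unfolding I_def by linarith
    moreover have [simp]: "reg s ''n'' = n"
      using fr g by (simp add: same_def node_body_def arc_body_def graph_input_def)
    ultimately show ?case
      using I W_bounds by (simp add: I_def)
  next
    case (3 s t)
    note I = 3(1) and fr = 3(2)
    have g': "graph_input s"
      using fr g by (auto simp: same_def node_body_def arc_body_def graph_input_def)
    then have [simp]: "reg s ''n'' = n" "reg s ''m'' = m" by (auto simp: graph_input_def)
    have p: "reg s ''p'' < 2 * n" and c: "reg s ''c'' = adj_start (reg s ''p'')"
      using I 3(3) by (auto simp: I_def)
    note pb = adj_start_mono[of _ "reg s ''p''"]
    let ?s = "set_reg ''e'' 0 (set_arr ''off'' (reg s ''p'') (reg s ''c'') s)"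
    have w: "wp W (While (Less (Reg ''e'') (Reg ''m'')) arc_body)
        (wp W (incr ''p'') I) ?s u" if "u \<le> t + 20" for u
    proof (rule wp_conseq[OF wp_arcs], goal_cases)
      case 1 show ?case using g' by (simp add: graph_input_def)
    next
      case 2 show ?case using p by simp
    next
      case 3 show ?case using adj_start_le c by simp
    next
      case 4 show ?case by simp
    next
      case (5 s' t')
      have fr: "reg s' ''p'' = reg s ''p''" "arr s' ''off'' = (arr s ''off'')(reg s ''p'' := reg s ''c'')"
        using 5(2) by (auto simp: same_def arc_body_def)
      \<comment> \<open>Lists of earlier nodes end at or below
        \<open>adj_start (reg s ''p'')\<close>, where the current writes begin.\<close>
      have "arr s' ''adj'' ` {adj_start q..<adj_start (Suc q)} = arr s ''adj'' ` {adj_start q..<adj_start (Suc q)}"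
        if "q < reg s ''p''" for q
        using 5(1) pb[of "Suc q"] that c by (intro image_cong) auto
      then show ?case
        using 5(1) I p c adj_start that by (auto simp: I_def fr adj_start_Suc less_Suc_eq algebra_simps)
    qed
    show ?case
      using w p c adj_start W_bounds by (simp add: node_body_def)
  next
    case (4 s t)
    then have "reg s ''p'' = 2 * n"
      using g by (auto simp: I_def same_def node_body_def arc_body_def graph_input_def)
    then show ?case
      using 4(1) adj_start by (auto simp: I_def adj_lists_def algebra_simps)
  qed
  then show ?thesis
    using W_bounds by (simp add: build_adj_def numeral_eq_Suc)
qed

lemma wp_init_row:
  assumes g: "graph_input s0" and z: "\<And>v. arr s0 ''row'' v = 0"
  shows "wp W init_row (\<lambda>s t. reg s ''k'' = 1 \<and> (\<forall>v. arr s ''row'' v = (if v \<in> fst ` E then 1 else 0)) \<and>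
     t \<le> t0 + 50 * (m + 1)) s0 t0"
proof -
  define I where "I = (\<lambda>(s :: state) t. reg s ''e'' \<le> m \<and>
       (\<forall>v. arr s ''row'' v = (if \<exists>e<reg s ''e''. fst (es ! e) = v then 1 else 0)) \<and>
       t \<le> t0 + 10 + 50 * reg s ''e'')"
  have "wp W (While (Less (Reg ''e'') (Reg ''m'')) mark_tail)
     (wp W (Assign ''k'' (Const 1)) (\<lambda>s t. reg s ''k'' = 1 \<and>
         (\<forall>v. arr s ''row'' v = (if v \<in> fst ` E then 1 else 0)) \<and>
     t \<le> t0 + 50 * (m + 1)))
     (set_reg ''e'' 0 s0) (t0 + 2)"
  proof (rule wp_While[where I = I and B = "t0 + 10 + 50 * m"], goal_cases)
    case 1
    show ?case by (simp add: I_def z)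
  next
    case (2 s t)
    moreover have "reg s ''m'' = m"
      using 2(2) g by (auto simp: same_def mark_tail_def graph_input_def)
    ultimately show ?case
      using W_bounds by (auto simp: I_def)
  next
    case (3 s t)
    have g': "reg s ''m'' = m" "\<And>e. e < m \<Longrightarrow> arr s ''tail'' e = fst (es ! e)"
      using 3(2) g by (auto simp: same_def mark_tail_def graph_input_def)
    with 3(3) have "reg s ''e'' < m" by simp
    with ends_less[OF this] g' 3(1) W_bounds show ?case
      by (auto simp: I_def mark_tail_def less_Suc_eq)
  next
    case (4 s t)
    then have "reg s ''e'' = m"
      using g by (auto simp: I_def same_def mark_tail_def graph_input_def)
    moreover have "v \<in> fst ` E \<longleftrightarrow> (\<exists>e<m. fst (es ! e) = v)" for v
      using in_set_conv_nth[of v "map fst es"] by auto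
    ultimately show ?case
      using 4(1) W_bounds by (auto simp: I_def)
  qed
  then show ?thesis
    by (simp add: init_row_def)
qed

section \<open>Vertex sets as rows of bits: marking, splitting, listing\<close>

definition row :: "state \<Rightarrow> nat \<Rightarrow> nat set" where
  "row s j = {v. v < n \<and> arr s ''row'' (j * n + v) = 1}"

definition bits :: "state \<Rightarrow> bool" where
  "bits s \<longleftrightarrow> (\<forall>j v. v < n \<longrightarrow> arr s ''row'' (j * n + v) \<le> 1)"

lemma cell_inj: "u < n \<Longrightarrow> v < n \<Longrightarrow> j * n + u = l * n + v \<longleftrightarrow> j = l \<and> u = v"
  by (metis add.commute div_mult_self1_is_m div_mult_self3 div_less gr_implies_not0 mod_less mod_mult_self1 add_0)

lemma finite_row [simp]: "finite (row s j)"
  by (simp add: row_def)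

lemma cell_bound: "j \<le> n + 1 \<Longrightarrow> v \<le> n \<Longrightarrow> j * n + v \<le> W \<and> j * n \<le> W"
  using W_bounds mult_le_mono1[of j "n + 1" n] by (simp add: algebra_simps)

text \<open>Vertices are scanned in increasing order, so the first member found, which seeds the
  queue, is \<open>Min Y\<close>. This gives the search a root that depends on \<open>Y\<close>
  alone, as \<open>passed\<close> requires.\<close>

lemma wp_clear_marks:
  assumes [simp]: "reg s0 ''n'' = n" and i: "reg s0 ''i'' \<le> n" and b: "bits s0"
    and xy: "reg s0 ''x'' < n" "reg s0 ''y'' < n"
  defines "Y \<equiv> row s0 (reg s0 ''i'') - {reg s0 ''x'', reg s0 ''y''}"
  shows "wp W clear_marks (\<lambda>s t. reg s ''cnt'' = card Y \<and> reg s ''qt'' = (if Y = {} then 0 else 1) \<and>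
      (Y \<noteq> {} \<longrightarrow> arr s ''queue'' 0 = Min Y) \<and>
      (\<forall>v<n. arr s ''mark'' v = (if v \<notin> Y then 0 else if v = Min Y then 2 else 1)) \<and>
      t \<le> t0 + 100 * (n + 1)) s0 t0"
proof -
  define Z where "Z v = {u\<in>Y. u < v}" for v
  define I where "I = (\<lambda>(s :: state) t. reg s ''v'' \<le> n \<and> reg s ''cnt'' = card (Z (reg s ''v'')) \<and>
      reg s ''qt'' = (if Z (reg s ''v'') = {} then 0 else 1) \<and>
      (Z (reg s ''v'') \<noteq> {} \<longrightarrow> arr s ''queue'' 0 = Min Y) \<and>
      (\<forall>v<reg s ''v''. arr s ''mark'' v = (if v \<notin> Y then 0 else if v = Min Y then 2 else 1)) \<and>
      t \<le> t0 + 10 + 100 * reg s ''v'')"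
  have finY: "finite Y" by (simp add: Y_def)
  have Yn: "Y \<subseteq> {..<n}" by (auto simp: Y_def row_def)
  have Zn: "Z n = Y" using Yn by (auto simp: Z_def)
  have Z0: "Z 0 = {}" by (simp add: Z_def)
  have finZ: "finite (Z v)" for v using finY by (simp add: Z_def)
  have ZSuc: "Z (Suc v) = (if v \<in> Y then insert v (Z v) else Z v)" for v
    by (auto simp: Z_def less_Suc_eq)
  have vZ: "v \<notin> Z v" for v by (simp add: Z_def)
  have min1: "Min Y = v" if "v \<in> Y" "Z v = {}" for v
    using that finY by (intro Min_eqI) (auto simp: Z_def not_less)
  have min2: "v \<noteq> Min Y" if ne: "Z v \<noteq> {}" for v
  proof -
    obtain u where "u \<in> Y" "u < v" using ne by (auto simp: Z_def)
    with Min_le[OF finY, of u] show ?thesis by simp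
  qed
  have cardZ: "card (Z v) \<le> v" for v
    using card_mono[of "{..<v}" "Z v"] by (auto simp: Z_def)
  have "wp W (While (Less (Reg ''v'') (Reg ''n'')) clear_body)
     (\<lambda>s t. reg s ''cnt'' = card Y \<and> reg s ''qt'' = (if Y = {} then 0 else 1) \<and>
      (Y \<noteq> {} \<longrightarrow> arr s ''queue'' 0 = Min Y) \<and>
      (\<forall>v<n. arr s ''mark'' v = (if v \<notin> Y then 0 else if v = Min Y then 2 else 1)) \<and>
      t \<le> t0 + 100 * (n + 1))
     (set_reg ''qt'' 0 (set_reg ''cnt'' 0 (set_reg ''v'' 0 s0))) u" if "u \<le> t0 + 10" for u
  proof (rule wp_While[where I = I and B = "t0 + 10 + 100 * n"], goal_cases)
    case 1
    show ?case using that by (simp add: I_def Z0)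
  next
    case (2 s t)
    moreover have "reg s ''n'' = n"
      using 2(2) by (simp add: same_def clear_body_def)
    ultimately show ?case
      using W_bounds by (auto simp: I_def)
  next
    case (3 s t)
    have fr: "reg s ''n'' = n" "reg s ''i'' = reg s0 ''i''" "reg s ''x'' = reg s0 ''x''"
      "reg s ''y'' = reg s0 ''y''" "arr s ''row'' = arr s0 ''row''"
      using 3(2) by (auto simp: same_def clear_body_def)
    with 3(3) have v: "reg s ''v'' < n" by simp
    define v where "v = reg s ''v''"
    have bit: "arr s0 ''row'' (reg s0 ''i'' * n + v) \<le> 1"
      using b v by (auto simp: bits_def v_def)
    have vY: "v \<in> Y \<longleftrightarrow> arr s0 ''row'' (reg s0 ''i'' * n + v) = 1 \<and> v \<noteq> reg s0 ''x'' \<and> v \<noteq> reg s0 ''y''"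
      using v by (auto simp: Y_def row_def v_def)
    have cb: "reg s0 ''i'' * n + v \<le> W" "reg s0 ''i'' * n \<le> W"
      using cell_bound[of "reg s0 ''i''" v] i v by (auto simp: v_def)
    have c0: "card (Z v) = 0 \<longleftrightarrow> Z v = {}" using finZ by simp
    show ?case
    proof (cases "v \<in> Y")
      case True
      show ?thesis
      proof (cases "Z v = {}")
        case em: True
        show ?thesis
          using 3(1) v cb bit xy i W_bounds True vY vZ[of v] finZ[of v] em min1[OF True em]
          by (simp add: I_def clear_body_def fr ZSuc v_def[symmetric] less_Suc_eq)
      next
        case ne: False
        then have "card (Z v) \<noteq> 0" using c0 by simp
        then show ?thesis
          using 3(1) v cb bit xy i W_bounds True vY vZ[of v] finZ[of v] ne min2[OF ne] cardZ[of v]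
          by (simp add: I_def clear_body_def fr ZSuc v_def[symmetric] less_Suc_eq)
      qed
    next
      case False
      then consider "arr s0 ''row'' (reg s0 ''i'' * n + v) = 0"
        | "arr s0 ''row'' (reg s0 ''i'' * n + v) = 1" "v = reg s0 ''x''"
        | "arr s0 ''row'' (reg s0 ''i'' * n + v) = 1" "v \<noteq> reg s0 ''x''" "v = reg s0 ''y''"
        using vY bit by linarith
      then show ?thesis
        by cases (use 3(1) v cb xy i W_bounds False in
          \<open>simp_all add: I_def clear_body_def fr ZSuc v_def[symmetric] less_Suc_eq\<close>)
    qed
  next
    case (4 s t)
    then have "reg s ''v'' = n"
      by (auto simp: I_def same_def clear_body_def)
    then show ?case
      using 4(1) by (auto simp: I_def Zn)
  qed
  then show ?thesis
    by (simp add: clear_marks_def)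
qed

definition split_low :: "state \<Rightarrow> nat \<Rightarrow> nat" where
  "split_low s v = (if v = reg s ''x'' \<or> v = reg s ''y'' \<or> arr s ''mark'' v = 2
     then arr s ''row'' (reg s ''i'' * n + v) else 0)"

definition split_high :: "state \<Rightarrow> nat \<Rightarrow> nat" where
  "split_high s v = (if v = reg s ''x'' \<or> v = reg s ''y'' then 1
     else if arr s ''mark'' v = 2 then 0 else arr s ''row'' (reg s ''i'' * n + v))"

lemma wp_split_cells:
  assumes [simp]: "reg s0 ''n'' = n" and i: "reg s0 ''i'' < reg s0 ''k''" and k: "reg s0 ''k'' \<le> n"
    and b: "bits s0" and v0: "reg s0 ''v'' = 0"
    and xy: "reg s0 ''x'' < n" "reg s0 ''y'' < n" and mark: "\<And>v. v < n \<Longrightarrow> arr s0 ''mark'' v \<le> 2"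
  shows "wp W (While (Less (Reg ''v'') (Reg ''n'')) split_body)
     (\<lambda>s t. (\<forall>j v. v < n \<longrightarrow> arr s ''row'' (j * n + v) =
        (if j = reg s0 ''k'' then split_high s0 v else if j = reg s0 ''i'' then split_low s0 v
         else arr s0 ''row'' (j * n + v))) \<and>
      t \<le> t0 + 100 * (n + 1)) s0 t0"
proof -
  define I where "I = (\<lambda>(s :: state) t. reg s ''v'' \<le> n \<and>
      (\<forall>j v. v < n \<longrightarrow> arr s ''row'' (j * n + v) =
        (if j = reg s0 ''k'' \<and> v < reg s ''v'' then split_high s0 v
         else if j = reg s0 ''i'' \<and> v < reg s ''v'' then split_low s0 v
         else arr s0 ''row'' (j * n + v))) \<and> 
      t \<le> t0 + 100 * reg s ''v'')"
  show ?thesis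
  proof (rule wp_While[where I = I and B = "t0 + 100 * n"], goal_cases)
    case 1
    show ?case by (simp add: I_def v0)
  next
    case (2 s t)
    moreover have "reg s ''n'' = n"
      using 2(2) by (simp add: same_def split_body_def)
    ultimately show ?case
      using W_bounds by (auto simp: I_def)
  next
    case (3 s t)
    have fr: "reg s ''n'' = n" "reg s ''i'' = reg s0 ''i''" "reg s ''x'' = reg s0 ''x''" "reg s ''k'' = reg s0 ''k''"
      "reg s ''y'' = reg s0 ''y''" "arr s ''mark'' = arr s0 ''mark''"
      using 3(2) by (auto simp: same_def split_body_def)
    define v where "v = reg s ''v''"
    with fr 3(3) have v: "v < n" by simp
    have bit: "arr s0 ''row'' (reg s0 ''i'' * n + v) \<le> 1"
      using b v by (auto simp: bits_def v_def)
    have cell: "arr s ''row'' (reg s0 ''i'' * n + v) = arr s0 ''row'' (reg s0 ''i'' * n + v)"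
      using 3(1) v by (auto simp: I_def v_def)
    have cb: "reg s0 ''i'' * n + v \<le> W" "reg s0 ''i'' * n \<le> W" "reg s0 ''k'' * n + v \<le> W" "reg s0 ''k'' * n \<le> W"
      using cell_bound[of "reg s0 ''i''" v] cell_bound[of "reg s0 ''k''" v] i k v by auto
    have m: "arr s0 ''mark'' v \<le> W" using mark[OF v] W_bounds by simp
    have Wb: "n \<le> W" "Suc v \<le> W" "v \<le> W" "2 \<le> W" "Suc 0 \<le> W" "reg s0 ''k'' \<le> W"
      "reg s0 ''i'' \<le> W" "reg s0 ''x'' \<le> W" "reg s0 ''y'' \<le> W" "arr s0 ''row'' (reg s0 ''i'' * n + v) \<le> W"
      using W_bounds v i k xy bit by simp_all
    have ne: "reg s0 ''k'' \<noteq> reg s0 ''i''" using i by simp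
    have n0: "0 < n" using v by simp
    have ind: "u < n \<Longrightarrow> j * n + u = l * n + v \<longleftrightarrow> j = l \<and> u = v" for j l u
      using cell_inj[OF _ v] .
    have I: "\<And>j u. u < n \<Longrightarrow> arr s ''row'' (j * n + u) =
        (if j = reg s0 ''k'' \<and> u < v then split_high s0 u
         else if j = reg s0 ''i'' \<and> u < v then split_low s0 u
         else arr s0 ''row'' (j * n + u))" "t \<le> t0 + 100 * v"
      using 3(1) by (auto simp: I_def v_def)
    define F where "F v j u = (if j = reg s0 ''k'' \<and> u < v then split_high s0 u
         else if j = reg s0 ''i'' \<and> u < v then split_low s0 u
         else arr s0 ''row'' (j * n + u))" for v j u
    \<comment> \<open>All three branches of the body are instances of this double update; in two of
      them the write to row \<open>i\<close> puts back the value already there.\<close>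
    have F: "\<forall>j u. u < n \<longrightarrow> ((arr s ''row'')(reg s0 ''k'' * n + v := split_high s0 v,
        reg s0 ''i'' * n + v := split_low s0 v)) (j * n + u) = F (Suc v) j u"
    proof (intro allI impI)
      fix j u assume u: "u < n"
      show "((arr s ''row'')(reg s0 ''k'' * n + v := split_high s0 v,
        reg s0 ''i'' * n + v := split_low s0 v)) (j * n + u) = F (Suc v) j u"
      proof (cases "u = v")
        case True
        then show ?thesis using ne n0 I(1)[OF v, of j] by (simp add: F_def)
      next
        case False
        then show ?thesis using ne by (simp add: F_def ind[OF u] I(1)[OF u] less_Suc_eq)
      qed
    qed
    have kn: "reg s0 ''k'' * n + v \<noteq> reg s0 ''i'' * n + v" using ne n0 by simp
    have J: "I s' t' \<longleftrightarrow> reg s' ''v'' \<le> n \<and>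
      (\<forall>j u. u < n \<longrightarrow> arr s' ''row'' (j * n + u) = F (reg s' ''v'') j u) \<and> t' \<le> t0 + 100 * reg s' ''v''" for s' t'
      by (simp add: I_def F_def)
    consider (A) "v = reg s0 ''x'' \<or> v = reg s0 ''y''"
      | (B) "v \<noteq> reg s0 ''x''" "v \<noteq> reg s0 ''y''" "arr s0 ''mark'' v = 2"
      | (C) "v \<noteq> reg s0 ''x''" "v \<noteq> reg s0 ''y''" "arr s0 ''mark'' v \<noteq> 2"
      by blast
    then show ?case
    proof cases
      case A
      then have low: "split_low s0 v = arr s ''row'' (reg s0 ''i'' * n + v)" and high: "split_high s0 v = 1"
        by (auto simp: split_low_def split_high_def cell)
      have "(arr s ''row'')(reg s0 ''k'' * n + v := split_high s0 v, reg s0 ''i'' * n + v := split_low s0 v) =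
          (arr s ''row'')(reg s0 ''k'' * n + v := 1)"
        using kn by (simp add: low high fun_eq_iff)
      with F have "\<forall>j u. u < n \<longrightarrow> ((arr s ''row'')(reg s0 ''k'' * n + v := 1)) (j * n + u) = F (Suc v) j u"
        by simp
      moreover have n: "(v \<noteq> reg s0 ''x'' \<and> v \<noteq> reg s0 ''y'') = False" using A by blast
      ultimately show ?thesis
        using v cb Wb I(2)
        by (simp add: J split_body_def fr v_def[symmetric] n)
    next
      case B
      then have low: "split_low s0 v = arr s ''row'' (reg s0 ''i'' * n + v)" and high: "split_high s0 v = 0"
        by (auto simp: split_low_def split_high_def cell)
      have "(arr s ''row'')(reg s0 ''k'' * n + v := split_high s0 v, reg s0 ''i'' * n + v := split_low s0 v) =
          (arr s ''row'')(reg s0 ''k'' * n + v := 0)"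
        using kn by (simp add: low high fun_eq_iff)
      with F have "\<forall>j u. u < n \<longrightarrow> ((arr s ''row'')(reg s0 ''k'' * n + v := 0)) (j * n + u) = F (Suc v) j u"
        by simp
      with B show ?thesis
        using v cb Wb I(2)
        by (simp add: J split_body_def fr v_def[symmetric])
    next
      case C
      then have low: "split_low s0 v = 0" and high: "split_high s0 v = arr s ''row'' (reg s0 ''i'' * n + v)"
        by (auto simp: split_low_def split_high_def cell)
      from C F show ?thesis
        using v cb m Wb I(2) unfolding low high
        by (simp add: J split_body_def fr v_def[symmetric] cell)
    qed
  next
    case (4 s t)
    then have "reg s ''v'' = n"
      by (auto simp: I_def same_def split_body_def)
    then show ?case
      using 4(1) by (auto simp: I_def)
  qed
qed

lemma wp_split_row:
  assumes n: "reg s0 ''n'' = n" and i: "reg s0 ''i'' < reg s0 ''k''" and k: "reg s0 ''k'' \<le> n"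
    and b: "bits s0" and mark: "\<And>v. v < n \<Longrightarrow> arr s0 ''mark'' v \<le> 2"
    and xy: "reg s0 ''x'' \<in> row s0 (reg s0 ''i'')" "reg s0 ''y'' \<in> row s0 (reg s0 ''i'')"
    and S: "S = {v. v < n \<and> arr s0 ''mark'' v = 2}" "S \<subseteq> row s0 (reg s0 ''i'') - {reg s0 ''x'', reg s0 ''y''}"
  shows "wp W split_row (\<lambda>s t. bits s \<and> reg s ''k'' = Suc (reg s0 ''k'') \<and> reg s ''q'' = 0 \<and>
      (\<forall>j\<le>reg s0 ''k''. row s j = ((row s0)(reg s0 ''i'' := insert (reg s0 ''x'') (insert (reg s0 ''y'') S),
        reg s0 ''k'' := row s0 (reg s0 ''i'') - S)) j) \<and>
      t \<le> t0 + 150 * (n + 1)) s0 t0"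
proof -
  have xyn: "reg s0 ''x'' < n" "reg s0 ''y'' < n" using xy by (auto simp: row_def)
  define Q where "Q = (\<lambda>s t. bits s \<and> reg s ''k'' = Suc (reg s0 ''k'') \<and> reg s ''q'' = 0 \<and>
      (\<forall>j\<le>reg s0 ''k''. row s j = ((row s0)(reg s0 ''i'' := insert (reg s0 ''x'') (insert (reg s0 ''y'') S),
        reg s0 ''k'' := row s0 (reg s0 ''i'') - S)) j) \<and>
      t \<le> t0 + 150 * (n + 1))"
  let ?s = "set_reg ''v'' 0 s0"
  have eqs: "split_high ?s = split_high s0" "split_low ?s = split_low s0"
    by (auto simp: split_high_def split_low_def fun_eq_iff)
  have "wp W (While (Less (Reg ''v'') (Reg ''n'')) split_body)
     (wp W (incr ''k'') (wp W (Assign ''q'' (Const 0)) Q)) ?s u" if "u \<le> t0 + 10" for u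
  proof (rule wp_conseq[OF wp_split_cells], goal_cases)
    case (9 s t)
    have fr: "reg s ''k'' = reg s0 ''k''"
      using 9(2) by (auto simp: same_def split_body_def)
    have cells: "arr s ''row'' (j * n + v) =
        (if j = reg s0 ''k'' then split_high s0 v else if j = reg s0 ''i'' then split_low s0 v
         else arr s0 ''row'' (j * n + v))" if "v < n" for j v
      using 9(1) that by (simp add: eqs)
    have Sm: "arr s0 ''mark'' v = 2 \<longleftrightarrow> v \<in> S" if "v < n" for v
      using that S(1) by simp
    have xyS: "reg s0 ''x'' \<notin> S" "reg s0 ''y'' \<notin> S" using S(2) by auto
    have r: "arr s0 ''row'' (reg s0 ''i'' * n + v) = 1 \<longleftrightarrow> v \<in> row s0 (reg s0 ''i'')" if "v < n" for v
      using that by (simp add: row_def)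
    have high: "split_high s0 v = 1 \<longleftrightarrow> v \<in> row s0 (reg s0 ''i'') - S" if "v < n" for v
      using r[OF that] Sm[OF that] xy xyS by (auto simp: split_high_def)
    have low: "split_low s0 v = 1 \<longleftrightarrow> v \<in> insert (reg s0 ''x'') (insert (reg s0 ''y'') S)" if "v < n" for v
      using r[OF that] Sm[OF that] xy S(2) by (auto simp: split_low_def)
    have "bits s"
      using b unfolding bits_def by (auto simp: cells split_high_def split_low_def)
    moreover have "row s (reg s0 ''k'') = row s0 (reg s0 ''i'') - S"
      using high unfolding row_def[of s] by (auto simp: cells row_def[of s0])
    moreover have "row s (reg s0 ''i'') = insert (reg s0 ''x'') (insert (reg s0 ''y'') S)"
    proof -
      have "S \<subseteq> {..<n}" using S(1) by auto
      then show ?thesis using low xyn i unfolding row_def[of s] by (auto simp: cells)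
    qed
    moreover have "row s j = row s0 j" if "j \<noteq> reg s0 ''i''" "j \<noteq> reg s0 ''k''" for j
      using that by (auto simp: row_def cells)
    ultimately show ?case
      using 9(1) that k W_bounds by (auto simp: Q_def fr row_def bits_def)
  qed (use n i k b xyn mark in \<open>auto simp: bits_def\<close>)
  then have "wp W split_row Q s0 t0"
    by (simp add: split_row_def)
  then show ?thesis by (simp only: Q_def)
qed

lemma wp_emit_cells:
  assumes [simp]: "reg s0 ''n'' = n" and i: "reg s0 ''i'' \<le> n" and b: "bits s0"
    and v0: "reg s0 ''v'' = 0" and p0: "reg s0 ''p'' = reg s0 ''pos''" and pos: "reg s0 ''pos'' \<le> n * n"
  shows "wp W (While (Less (Reg ''v'') (Reg ''n'')) emit_body)
     (\<lambda>s t. reg s ''p'' = reg s0 ''pos'' + card (row s0 (reg s0 ''i'')) \<and>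
      map (arr s ''out'') [reg s0 ''pos''..<reg s ''p''] = filter (\<lambda>v. v \<in> row s0 (reg s0 ''i'')) [0..<n] \<and>
      (\<forall>p<reg s0 ''pos''. arr s ''out'' p = arr s0 ''out'' p) \<and>
      t \<le> t0 + 50 * (n + 1)) s0 t0"
proof -
  let ?L = "\<lambda>v. filter (\<lambda>v. v \<in> row s0 (reg s0 ''i'')) [0..<v]"
  define I where "I = (\<lambda>(s :: state) t. reg s ''v'' \<le> n \<and>
      reg s ''p'' = reg s0 ''pos'' + length (?L (reg s ''v'')) \<and>
      map (arr s ''out'') [reg s0 ''pos''..<reg s ''p''] = ?L (reg s ''v'') \<and>
      (\<forall>p<reg s0 ''pos''. arr s ''out'' p = arr s0 ''out'' p) \<and>
      t \<le> t0 + 50 * reg s ''v'')"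
  have len: "length (?L n) = card (row s0 (reg s0 ''i''))"
  proof -
    have "length (?L n) = card (set (?L n))"
      by (rule distinct_card[symmetric]) simp
    also have "set (?L n) = row s0 (reg s0 ''i'')" by (auto simp: row_def)
    finally show ?thesis .
  qed
  have lenv: "length (?L v) \<le> v" for v
    using length_filter_le[of _ "[0..<v]"] by simp
  show ?thesis
  proof (rule wp_While[where I = I and B = "t0 + 50 * n"], goal_cases)
    case 1
    show ?case by (simp add: I_def v0 p0)
  next
    case (2 s t)
    moreover have "reg s ''n'' = n"
      using 2(2) by (simp add: same_def emit_body_def)
    ultimately show ?case
      using W_bounds by (auto simp: I_def)
  next
    case (3 s t)
    have fr: "reg s ''n'' = n" "reg s ''i'' = reg s0 ''i''" "arr s ''row'' = arr s0 ''row''"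
      using 3(2) by (auto simp: same_def emit_body_def)
    define v where "v = reg s ''v''"
    with fr 3(3) have v: "v < n" by simp
    have bit: "arr s0 ''row'' (reg s0 ''i'' * n + v) \<le> 1"
      using b v by (auto simp: bits_def v_def)
    have cb: "reg s0 ''i'' * n + v \<le> W" "reg s0 ''i'' * n \<le> W" "reg s ''p'' \<le> n * n + n"
      using cell_bound[of "reg s0 ''i''" v] i v pos lenv[of v] 3(1) by (auto simp: I_def v_def)
    have I: "reg s ''p'' = reg s0 ''pos'' + length (?L v)"
      "map (arr s ''out'') [reg s0 ''pos''..<reg s ''p''] = ?L v"
      "\<forall>p<reg s0 ''pos''. arr s ''out'' p = arr s0 ''out'' p" "t \<le> t0 + 50 * v"
      using 3(1) by (auto simp: I_def v_def)
    have upd: "map ((arr s ''out'')(reg s ''p'' := v)) [reg s0 ''pos''..<Suc (reg s ''p'')] = ?L v @ [v]"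
      using I(1,2) by (auto simp: map_fun_upd)
    have Wp: "Suc (reg s ''p'') \<le> W" "v + 1 \<le> W" "1 \<le> W"
      using cb(3) v W_bounds by (simp_all add: algebra_simps)
    have vr: "v \<in> row s0 (reg s0 ''i'') \<longleftrightarrow> arr s0 ''row'' (reg s0 ''i'' * n + v) = 1"
      using v by (simp add: row_def)
    have L: "?L (Suc v) = (if v \<in> row s0 (reg s0 ''i'') then ?L v @ [v] else ?L v)"
      by simp
    show ?case
    proof (cases "v \<in> row s0 (reg s0 ''i'')")
      case True
      then show ?thesis
        using I(1,3,4) upd vr Wp cb v bit W_bounds i
        by (simp add: I_def emit_body_def fr v_def[symmetric] L del: upt_Suc)
    next
      case False
      then show ?thesis
        using I vr Wp cb v bit W_bounds i
        by (simp add: I_def emit_body_def fr v_def[symmetric])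
    qed
  next
    case (4 s t)
    then have "reg s ''v'' = n"
      by (auto simp: I_def same_def emit_body_def)
    then show ?case
      using 4(1) len by (auto simp: I_def)
  qed
qed

section \<open>Graph search in either direction\<close>

definition dir :: "nat \<Rightarrow> nat rel" where
  "dir d = (if d = 0 then E else E\<inverse>)"

lemma nbrs_dir: "d < 2 \<Longrightarrow> u < n \<Longrightarrow> nbrs (d * n + u) m = dir d `` {u}"
  by (auto simp: nbrs_eq dir_def less_2_cases_iff)

lemma dir_less: "(a, b) \<in> dir d \<Longrightarrow> b < n"
  using range by (auto simp: dir_def split: if_splits)

text \<open>\<open>S\<close> is the set of visited vertices. Vertices before \<open>qh\<close> are
  fully processed, the one at \<open>qh\<close> up to entry \<open>j\<close> of its list. That
  \<open>j\<close> is 0 when the queue is exhausted is needed for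
  \<open>j \<le> work d queue qh\<close>.\<close>

definition search_inv ::
    "nat \<Rightarrow> nat set \<Rightarrow> (nat \<Rightarrow> nat) \<Rightarrow> (nat \<Rightarrow> nat) \<Rightarrow> (nat \<Rightarrow> nat) \<Rightarrow> nat \<Rightarrow> nat \<Rightarrow> nat \<Rightarrow> bool" where
  "search_inv d Y adj mark queue qh qt j \<longleftrightarrow> (let S = queue ` {..<qt} in
     qh \<le> qt \<and> inj_on queue {..<qt} \<and> S \<subseteq> Y \<and> (Y \<noteq> {} \<longrightarrow> S \<noteq> {}) \<and>
     (\<forall>v<n. mark v = (if v \<in> S then 2 else if v \<in> Y then 1 else 0)) \<and>
     (\<forall>a\<in>S. (Min Y, a) \<in> (Restr (dir d) Y)\<^sup>*) \<and>
     (\<forall>l<qh. dir d `` {queue l} \<inter> Y \<subseteq> S) \<and>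
     (if qh < qt then j \<le> ndeg (d * n + queue qh) m \<and>
        (\<forall>l<j. adj (adj_start (d * n + queue qh) + l) \<in> Y \<longrightarrow> adj (adj_start (d * n + queue qh) + l) \<in> S)
      else j = 0))"

text \<open>A potential for the running time: each vertex not yet removed from the queue accounts
  for one step per list entry and one for its removal. Vertices that will never be queued are
  included, as the visited set is not known in advance.\<close>

definition work :: "nat \<Rightarrow> (nat \<Rightarrow> nat) \<Rightarrow> nat \<Rightarrow> nat" where
  "work d queue qh = (\<Sum>v\<in>{..<n} - queue ` {..<qh}. ndeg (d * n + v) m + 1)"

text \<open>The nodes \<open>d * n + v\<close> with \<open>v < n\<close> are consecutive, so the
  lengths of their lists telescope to a difference of values of \<open>adj_start\<close>.\<close>

lemma work_0: "d < 2 \<Longrightarrow> work d queue 0 \<le> 2 * m + n"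
proof -
  assume d: "d < 2"
  have "(\<Sum>v<k. ndeg (d * n + v) m) + adj_start (d * n) = adj_start (d * n + k)" for k
    by (induction k) (simp_all add: adj_start_Suc)
  from this[of n] have "(\<Sum>v<n. ndeg (d * n + v) m) \<le> 2 * m"
    using adj_start_le[of "d * n + n"] by simp
  then show ?thesis by (simp add: work_def sum_Suc)
qed

lemma search_inv_edge:
  assumes inv: "search_inv d Y adj mark queue qh qt j" and d: "d < 2" and Y: "Y \<subseteq> {..<n}"
    and adj: "\<And>p. p < 2 * n \<Longrightarrow> adj ` {adj_start p..<adj_start (Suc p)} = nbrs p m"
    and qh: "qh < qt" and j: "j < ndeg (d * n + queue qh) m"
  defines "w \<equiv> adj (adj_start (d * n + queue qh) + j)"
  shows "w < n"
    and "mark w \<noteq> 1 \<Longrightarrow> search_inv d Y adj mark queue qh qt (Suc j)"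
    and "mark w = 1 \<Longrightarrow> search_inv d Y adj (mark(w := 2)) (queue(qt := w)) qh (Suc qt) (Suc j)"
proof -
  let ?S = "queue ` {..<qt}" and ?u = "queue qh"
  note inv' = inv[unfolded search_inv_def Let_def]
  have u: "?u \<in> ?S" "?u \<in> Y" "?u < n" using inv' qh Y by auto
  have "d * n + ?u < 2 * n" using d u(3) by (auto simp: less_2_cases_iff)
  then have "adj ` {adj_start (d * n + ?u)..<adj_start (Suc (d * n + ?u))} = dir d `` {?u}"
    using adj nbrs_dir[OF d u(3)] by simp
  moreover have "w \<in> adj ` {adj_start (d * n + ?u)..<adj_start (Suc (d * n + ?u))}"
    using j by (auto simp: w_def adj_start_Suc)
  ultimately have uw: "(?u, w) \<in> dir d" by auto
  then show w: "w < n" by (rule dir_less)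
  have mark: "mark v = (if v \<in> ?S then 2 else if v \<in> Y then 1 else 0)" if "v < n" for v
    using inv' that by blast
  {
    assume "mark w \<noteq> 1"
    with mark[OF w] have "w \<in> Y \<longrightarrow> w \<in> ?S" by (simp split: if_split_asm)
    then have *: "\<forall>l<Suc j. adj (adj_start (d * n + ?u) + l) \<in> Y \<longrightarrow> adj (adj_start (d * n + ?u) + l) \<in> ?S"
      using inv' qh by (simp add: less_Suc_eq w_def)
    show "search_inv d Y adj mark queue qh qt (Suc j)"
      unfolding search_inv_def Let_def if_P[OF qh] using inv'[unfolded if_P[OF qh]] Suc_leI[OF j] *
      by - (elim conjE, intro conjI; assumption)
  next
    assume "mark w = 1"
    with mark[OF w] have wY: "w \<in> Y" "w \<notin> ?S" by (simp_all split: if_split_asm)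
    have im: "(queue(qt := w)) ` {..<Suc qt} = insert w ?S"
      by (auto simp: lessThan_Suc)
    have low: "(queue(qt := w)) l = queue l" if "l < qt" for l
      using that by simp
    have inj: "inj_on (queue(qt := w)) {..<Suc qt}"
    proof -
      have "inj_on queue {..<qt}" using inv' by blast
      with wY(2) show ?thesis by (fastforce simp: inj_on_def less_Suc_eq)
    qed
    have "(Min Y, ?u) \<in> (Restr (dir d) Y)\<^sup>*" using inv' u(1) by blast
    then have reach: "(Min Y, w) \<in> (Restr (dir d) Y)\<^sup>*"
      using uw u(2) wY(1) by (auto intro: rtrancl_into_rtrancl)
    have *: "\<forall>v<n. (mark(w := 2)) v = (if v \<in> insert w ?S then 2 else if v \<in> Y then 1 else 0)"
      using mark by simp
    have **: "\<forall>l<qh. dir d `` {(queue(qt := w)) l} \<inter> Y \<subseteq> insert w ?S"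
    proof (intro allI impI)
      fix l assume l: "l < qh"
      then have "dir d `` {queue l} \<inter> Y \<subseteq> ?S" using inv' by blast
      with low[of l] l qh show "dir d `` {(queue(qt := w)) l} \<inter> Y \<subseteq> insert w ?S" by auto
    qed
    have ***: "\<forall>l<Suc j. adj (adj_start (d * n + ?u) + l) \<in> Y \<longrightarrow> adj (adj_start (d * n + ?u) + l) \<in> insert w ?S"
      using inv' qh by (simp add: less_Suc_eq w_def)
    show "search_inv d Y adj (mark(w := 2)) (queue(qt := w)) qh (Suc qt) (Suc j)"
      unfolding search_inv_def Let_def im low[OF qh] if_P[OF less_SucI[OF qh]]
    proof (intro conjI)
      show "insert w ?S \<subseteq> Y" using inv' wY(1) by blast
      show "\<forall>a\<in>insert w ?S. (Min Y, a) \<in> (Restr (dir d) Y)\<^sup>*" using inv' reach by blast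
    qed (use inj * ** *** qh j in simp_all)
  }
qed

lemma search_inv_pop:
  assumes inv: "search_inv d Y adj mark queue qh qt j" and d: "d < 2" and Y: "Y \<subseteq> {..<n}"
    and adj: "\<And>p. p < 2 * n \<Longrightarrow> adj ` {adj_start p..<adj_start (Suc p)} = nbrs p m"
    and qh: "qh < qt" and j: "\<not> j < ndeg (d * n + queue qh) m"
  shows "search_inv d Y adj mark queue (Suc qh) qt 0"
proof -
  let ?S = "queue ` {..<qt}" and ?u = "queue qh"
  note inv' = inv[unfolded search_inv_def Let_def]
  have u: "?u \<in> ?S" "?u \<in> Y" "?u < n" using inv' qh Y by auto
  have j': "j = ndeg (d * n + ?u) m" using inv' qh j by simp
  have "d * n + ?u < 2 * n" using d u(3) by (auto simp: less_2_cases_iff)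
  then have a: "adj ` {adj_start (d * n + ?u)..<adj_start (Suc (d * n + ?u))} = dir d `` {?u}"
    using adj nbrs_dir[OF d u(3)] by simp
  have "dir d `` {?u} \<inter> Y \<subseteq> ?S"
  proof
    fix w assume w: "w \<in> dir d `` {?u} \<inter> Y"
    then have "w \<in> adj ` {adj_start (d * n + ?u)..<adj_start (Suc (d * n + ?u))}" using a by blast
    then obtain p where p: "adj_start (d * n + ?u) \<le> p" "p < adj_start (Suc (d * n + ?u))" "w = adj p" by auto
    define l where "l = p - adj_start (d * n + ?u)"
    have "p = adj_start (d * n + ?u) + l" "l < j" using p by (auto simp: adj_start_Suc j' l_def)
    with inv' qh p(3) w show "w \<in> ?S" by auto
  qed
  then have "\<forall>l<Suc qh. dir d `` {queue l} \<inter> Y \<subseteq> ?S" using inv' by (simp add: less_Suc_eq)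
  with inv' qh show ?thesis unfolding search_inv_def Let_def by simp
qed

text \<open>No vertex is queued twice, so the vertex at \<open>qh\<close> is still counted and
  leaves the sum exactly now.\<close>

lemma work_Suc:
  assumes inv: "search_inv d Y adj mark queue qh qt j" and Y: "Y \<subseteq> {..<n}" and qh: "qh < qt"
  shows "work d queue qh = work d queue (Suc qh) + ndeg (d * n + queue qh) m + 1"
proof -
  note inv' = inv[unfolded search_inv_def Let_def]
  have "queue qh \<notin> queue ` {..<qh}"
    using inv' qh by (auto simp: inj_on_def) (metis lessThan_iff less_irrefl order_less_trans)
  moreover have "queue qh < n" using inv' qh Y by auto
  ultimately have "work d queue qh =
      ndeg (d * n + queue qh) m + 1 + (\<Sum>v\<in>{..<n} - queue ` {..<qh} - {queue qh}. ndeg (d * n + v) m + 1)"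
    unfolding work_def by (intro sum.remove) auto
  also have "{..<n} - queue ` {..<qh} - {queue qh} = {..<n} - queue ` {..<Suc qh}"
    by (auto simp: lessThan_Suc)
  finally show ?thesis by (simp add: work_def)
qed

text \<open>The first bound keeps queue positions within a word. The second cancels the credit
  \<open>100 * j\<close> in the time clause of the loop in \<open>wp_search\<close>.\<close>

lemma search_inv_bounds:
  assumes inv: "search_inv d Y adj mark queue qh qt j" and Y: "Y \<subseteq> {..<n}"
  shows "qt \<le> n" and "j \<le> work d queue qh"
proof -
  note inv' = inv[unfolded search_inv_def Let_def]
  have "card (queue ` {..<qt}) = qt" using inv' by (simp add: card_image)
  moreover have "card (queue ` {..<qt}) \<le> card {..<n}" using inv' Y by (intro card_mono) auto
  ultimately show "qt \<le> n" by simp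
  show "j \<le> work d queue qh"
    using inv' work_Suc[OF inv Y] by (cases "qh < qt") auto
qed

text \<open>Serves both outcomes: if \<open>S\<close> is a proper subset of \<open>Y\<close>, its
  closedness yields a splitting; if \<open>S = Y\<close>, reachability from \<open>Min Y\<close>
  yields \<open>passed\<close>.\<close>

lemma wp_search:
  assumes n: "reg s0 ''n'' = n" and base: "reg s0 ''base'' = d * n" and d: "d < 2"
    and lists: "adj_lists s0" and Y: "Y \<subseteq> {..<n}"
    and qt: "reg s0 ''qt'' = (if Y = {} then 0 else 1)"
    and q0: "Y \<noteq> {} \<Longrightarrow> arr s0 ''queue'' 0 = Min Y"
    and mark: "\<And>v. v < n \<Longrightarrow> arr s0 ''mark'' v = (if v \<notin> Y then 0 else if v = Min Y then 2 else 1)"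
  shows "wp W search (\<lambda>s t. t \<le> t0 + 100 * (2 * m + n + 1) \<and> (\<forall>v<n. arr s ''mark'' v \<le> 2) \<and>
    (\<exists>S\<subseteq>Y. S = {v. v < n \<and> arr s ''mark'' v = 2} \<and> reg s ''qt'' = card S \<and> (Y \<noteq> {} \<longrightarrow> S \<noteq> {}) \<and>
      dir d `` S \<inter> Y \<subseteq> S \<and> (\<forall>a\<in>S. (Min Y, a) \<in> (Restr (dir d) Y)\<^sup>*))) s0 t0"
proof -
  define Q where "Q = (\<lambda>(s :: state) t. t \<le> t0 + 100 * (2 * m + n + 1) \<and> (\<forall>v<n. arr s ''mark'' v \<le> 2) \<and>
    (\<exists>S\<subseteq>Y. S = {v. v < n \<and> arr s ''mark'' v = 2} \<and> reg s ''qt'' = card S \<and> (Y \<noteq> {} \<longrightarrow> S \<noteq> {}) \<and>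
      dir d `` S \<inter> Y \<subseteq> S \<and> (\<forall>a\<in>S. (Min Y, a) \<in> (Restr (dir d) Y)\<^sup>*)))"
  define I where "I = (\<lambda>(s :: state) t.
     search_inv d Y (arr s0 ''adj'') (arr s ''mark'') (arr s ''queue'') (reg s ''qh'') (reg s ''qt'') (reg s ''j'') \<and>
     t + 100 * work d (arr s ''queue'') (reg s ''qh'') \<le> t0 + 10 + 100 * (2 * m + n) + 100 * reg s ''j'')"
  have adj: "arr s0 ''adj'' ` {adj_start p..<adj_start (Suc p)} = nbrs p m" if "p < 2 * n" for p
    using lists that by (simp add: adj_lists_def)
  have finY: "finite Y" using Y by (rule finite_subset) simp
  have MinY: "Y \<noteq> {} \<Longrightarrow> Min Y \<in> Y" using finY by simp
  have "wp W (While (Less (Reg ''qh'') (Reg ''qt'')) search_body) Q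
      (set_reg ''j'' 0 (set_reg ''qh'' 0 s0)) u" if u: "u \<le> t0 + 10" for u
  proof (rule wp_While[where I = I and B = "t0 + 10 + 100 * (2 * m + n)"], goal_cases)
    case 1
    have "search_inv d Y (arr s0 ''adj'') (arr s0 ''mark'') (arr s0 ''queue'') 0 (reg s0 ''qt'') 0"
      using qt q0 mark MinY by (auto simp: search_inv_def lessThan_Suc)
    then show ?case using u work_0[OF d, of "arr s0 ''queue''"] by (simp add: I_def)
  next
    case (2 s t)
    have inv: "search_inv d Y (arr s0 ''adj'') (arr s ''mark'') (arr s ''queue'') (reg s ''qh'') (reg s ''qt'') (reg s ''j'')"
      and t: "t + 100 * work d (arr s ''queue'') (reg s ''qh'') \<le> t0 + 10 + 100 * (2 * m + n) + 100 * reg s ''j''"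
      using 2(1) by (simp_all add: I_def)
    have "reg s ''qh'' \<le> reg s ''qt''" using inv by (simp add: search_inv_def Let_def)
    with search_inv_bounds[OF inv Y] t W_bounds show ?case by simp
  next
    case (3 s t)
    have fr: "reg s ''base'' = d * n" "arr s ''off'' = arr s0 ''off''" "arr s ''adj'' = arr s0 ''adj''"
      using 3(2) base by (auto simp: same_def search_body_def)
    have inv: "search_inv d Y (arr s0 ''adj'') (arr s ''mark'') (arr s ''queue'') (reg s ''qh'') (reg s ''qt'') (reg s ''j'')"
      using 3(1) by (simp add: I_def)
    have qh: "reg s ''qh'' < reg s ''qt''" using 3(3) by simp
    define v where "v = arr s ''queue'' (reg s ''qh'')"
    define p where "p = d * n + v"
    have t: "t + 100 * work d (arr s ''queue'') (reg s ''qh'') \<le> t0 + 10 + 100 * (2 * m + n) + 100 * reg s ''j''"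
      using 3(1) by (simp add: I_def)
    have v: "v < n" using inv qh Y by (auto simp: search_inv_def Let_def v_def)
    then have p: "p < 2 * n" using d by (auto simp: p_def less_2_cases_iff)
    have off: "arr s0 ''off'' p = adj_start p" "arr s0 ''off'' (Suc p) = adj_start p + ndeg p m"
      using lists p by (auto simp: adj_lists_def adj_start_Suc)
    have j: "reg s ''j'' \<le> ndeg p m"
      using inv qh by (auto simp: search_inv_def Let_def v_def p_def)
    have qt: "reg s ''qt'' \<le> n" using search_inv_bounds[OF inv Y] by simp
    have b: "adj_start p + ndeg p m \<le> W" "p + 1 \<le> W" "n + 1 \<le> W" "ndeg p m \<le> W" "d * n \<le> W" "Suc (reg s ''j'') \<le> W"
      using adj_start_le[of "Suc p"] p W_bounds j ndeg_le[of p m] by (auto simp: adj_start_Suc p_def)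
    show ?case
    proof (cases "reg s ''j'' < ndeg p m")
      case True
      define w where "w = arr s0 ''adj'' (adj_start p + reg s ''j'')"
      note E = search_inv_edge[OF inv d Y adj qh, folded v_def p_def, OF _ True, folded w_def]
      have w: "w < n" using E(1) .
      have mw: "arr s ''mark'' w \<le> 2"
        using inv w by (auto simp: search_inv_def Let_def)
      have wk: "work d ((arr s ''queue'')(reg s ''qt'' := w)) (reg s ''qh'') = work d (arr s ''queue'') (reg s ''qh'')"
      proof -
        have "(arr s ''queue'')(reg s ''qt'' := w) ` {..<reg s ''qh''} = arr s ''queue'' ` {..<reg s ''qh''}"
          using qh by (intro image_cong) auto
        then show ?thesis by (simp add: work_def)
      qed
      show ?thesis
      proof (cases "arr s ''mark'' w = 1")
        case mark: True
        then show ?thesis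
          using E(3)[OF _ mark] True b qt qh v w mw wk t off
          by (simp add: I_def search_body_def fr v_def[symmetric] p_def[symmetric] w_def[symmetric])
      next
        case mark: False
        then show ?thesis
          using E(2)[OF _ mark] True b qt qh v w mw t off
          by (simp add: I_def search_body_def fr v_def[symmetric] p_def[symmetric] w_def[symmetric])
      qed
    next
      case False
      note E = search_inv_pop[OF inv d Y adj qh, folded v_def p_def, OF _ False]
      show ?thesis
        using E False b qt qh v off t j work_Suc[OF inv Y qh]
        by (simp add: I_def search_body_def fr v_def[symmetric] p_def[symmetric])
    qed
  next
    case (4 s t)
    have inv: "search_inv d Y (arr s0 ''adj'') (arr s ''mark'') (arr s ''queue'') (reg s ''qh'') (reg s ''qt'') (reg s ''j'')"
      using 4(1) by (simp add: I_def)
    note inv' = inv[unfolded search_inv_def Let_def]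
    let ?S = "arr s ''queue'' ` {..<reg s ''qt''}"
    have qh: "reg s ''qh'' = reg s ''qt''" using 4(3) inv' by simp
    have j: "reg s ''j'' = 0" using inv' qh by simp
    have "arr s ''mark'' v = 2 \<longleftrightarrow> v \<in> ?S" if "v < n" for v
      using inv' that by simp
    moreover have "?S \<subseteq> {..<n}" using inv' Y by blast
    ultimately have S: "?S = {v. v < n \<and> arr s ''mark'' v = 2}" by blast
    have "\<exists>S\<subseteq>Y. S = {v. v < n \<and> arr s ''mark'' v = 2} \<and> reg s ''qt'' = card S \<and> (Y \<noteq> {} \<longrightarrow> S \<noteq> {}) \<and>
      dir d `` S \<inter> Y \<subseteq> S \<and> (\<forall>a\<in>S. (Min Y, a) \<in> (Restr (dir d) Y)\<^sup>*)"
    proof (intro exI[of _ ?S] conjI S)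
      show "?S \<subseteq> Y" "Y \<noteq> {} \<longrightarrow> ?S \<noteq> {}" "\<forall>a\<in>?S. (Min Y, a) \<in> (Restr (dir d) Y)\<^sup>*"
        using inv' by blast+
      show "reg s ''qt'' = card ?S" using inv' by (simp add: card_image)
      have "dir d `` {arr s ''queue'' l} \<inter> Y \<subseteq> ?S" if "l < reg s ''qt''" for l
        using inv' that unfolding qh by blast
      then show "dir d `` ?S \<inter> Y \<subseteq> ?S" by blast
    qed
    moreover have "\<forall>v<n. arr s ''mark'' v \<le> 2" using inv' by simp
    ultimately show ?case
      using 4(1) j by (simp add: Q_def I_def)
  qed
  then have "wp W search Q s0 t0" using W_bounds by (simp add: search_def)
  then show ?thesis by (simp only: Q_def)
qed

section \<open>The output lists\<close>

definition out_inv :: "state \<Rightarrow> nat list list \<Rightarrow> bool" where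
  "out_inv s L \<longleftrightarrow> output_lists s = L \<and> reg s ''pos'' = arr s ''start'' (reg s ''count'') \<and>
     (\<forall>c\<le>reg s ''count''. arr s ''start'' c \<le> reg s ''pos'')"

definition enum :: "nat set \<Rightarrow> nat list" where
  "enum U = filter (\<lambda>v. v \<in> U) [0..<n]"

text \<open>All list boundaries are at most \<open>pos\<close>, so tentative writes from
  \<open>pos\<close> on leave the finished lists intact.\<close>

lemma out_inv_cong:
  assumes "out_inv s L" "reg s' ''count'' = reg s ''count''" "reg s' ''pos'' = reg s ''pos''"
    "arr s' ''start'' = arr s ''start''" "\<And>p. p < reg s ''pos'' \<Longrightarrow> arr s' ''out'' p = arr s ''out'' p"
  shows "out_inv s' L"
proof -
  have "output_lists s' = output_lists s"
    unfolding output_lists_def assms(2,4)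
  proof (intro map_cong refl)
    fix i p assume "i \<in> set [0..<reg s ''count'']" "p \<in> set [arr s ''start'' i..<arr s ''start'' (i + 1)]"
    then have "p < arr s ''start'' (i + 1)" "i + 1 \<le> reg s ''count''" by auto
    with assms(1) have "p < reg s ''pos''" unfolding out_inv_def by (meson order_less_le_trans)
    then show "arr s' ''out'' p = arr s ''out'' p" by (rule assms(5))
  qed
  with assms show ?thesis by (auto simp: out_inv_def)
qed

lemma out_inv_snoc:
  assumes o: "out_inv s L" and p: "reg s ''pos'' \<le> p"
  defines "s' \<equiv> set_reg ''pos'' p
    (set_arr ''start'' (Suc (reg s ''count'')) p (set_reg ''count'' (Suc (reg s ''count'')) s))"
  shows "out_inv s' (L @ [map (arr s ''out'') [reg s ''pos''..<p]])"
proof -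
  have "output_lists s' = output_lists s @ [map (arr s ''out'') [reg s ''pos''..<p]]"
    using o unfolding output_lists_def s'_def by (simp add: out_inv_def)
  with o p show ?thesis
    by (auto simp: out_inv_def s'_def le_Suc_eq intro: order_trans)
qed

lemma wp_emit_row:
  assumes n: "reg s0 ''n'' = n" and i: "reg s0 ''i'' \<le> n" and b: "bits s0"
    and pos: "reg s0 ''pos'' \<le> reg s0 ''i'' * n" and count: "reg s0 ''count'' \<le> reg s0 ''i''"
    and out: "out_inv s0 L"
  defines "U \<equiv> row s0 (reg s0 ''i'')"
  shows "wp W emit_row (\<lambda>s t. out_inv s (L @ (if 4 \<le> card U then [enum U] else [])) \<and>
     reg s ''pos'' \<le> Suc (reg s0 ''i'') * n \<and> reg s ''count'' \<le> Suc (reg s0 ''i'') \<and>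
     t \<le> t0 + 100 * (n + 1)) s0 t0"
proof -
  define Q where "Q = (\<lambda>(s :: state) t. out_inv s (L @ (if 4 \<le> card U then [enum U] else [])) \<and>
     reg s ''pos'' \<le> Suc (reg s0 ''i'') * n \<and> reg s ''count'' \<le> Suc (reg s0 ''i'') \<and>
     t \<le> t0 + 100 * (n + 1))"
  have pn: "reg s0 ''pos'' \<le> n * n" using pos i by (meson le_trans mult_le_mono1)
  have cardU: "card U \<le> n"
    using card_mono[of "{..<n}" U] by (auto simp: U_def row_def)
  let ?s = "set_reg ''p'' (reg s0 ''pos'') (set_reg ''v'' 0 s0)"
  have rw: "row ?s = row s0" by (simp add: row_def fun_eq_iff)
  have "wp W (While (Less (Reg ''v'') (Reg ''n'')) emit_body)
     (wp W (If (Less (Const 3) (Sub (Reg ''p'') (Reg ''pos'')))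
        (incr ''count'' ;;
         Write ''start'' (Reg ''count'') (Reg ''p'') ;;
         Assign ''pos'' (Reg ''p''))
        Skip) Q) ?s u" if u: "u \<le> t0 + 10" for u
  proof (rule wp_conseq[OF wp_emit_cells], goal_cases)
    case (7 s t)
    have fr: "reg s ''pos'' = reg s0 ''pos''" "reg s ''count'' = reg s0 ''count''" "arr s ''start'' = arr s0 ''start''"
      using 7(2) by (auto simp: same_def emit_body_def)
    have p: "reg s ''p'' = reg s0 ''pos'' + card U"
      and en: "map (arr s ''out'') [reg s0 ''pos''..<reg s0 ''pos'' + card U] = enum U"
      and low: "\<And>p. p < reg s0 ''pos'' \<Longrightarrow> arr s ''out'' p = arr s0 ''out'' p" and t: "t \<le> u + 50 * (n + 1)"
      using 7(1) by (auto simp: U_def rw enum_def)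
    have o: "out_inv s L"
      using out by (rule out_inv_cong) (simp_all add: fr low)
    note sn = out_inv_snoc[OF o, unfolded fr, of "reg s0 ''pos'' + card U", unfolded en]
    have Wb: "reg s0 ''pos'' + card U \<le> W" "Suc (reg s0 ''count'') \<le> W" "4 \<le> W"
      using pn cardU count i W_bounds by simp_all
    show ?case
    proof (cases "4 \<le> card U")
      case True
      then have "3 < card U" by simp
      with True show ?thesis
        using sn Wb t u count pos cardU by (simp add: fr p Q_def)
    next
      case False
      then have "\<not> 3 < card U" by simp
      with False show ?thesis
        using o Wb t u count pos cardU by (simp add: fr p Q_def)
    qed
  qed (use n i b pn in \<open>auto simp: bits_def\<close>)
  then have "wp W emit_row Q s0 t0"
    using pn W_bounds by (simp add: emit_row_def)
  then show ?thesis by (simp only: Q_def)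
qed

section \<open>Testing one pair in one direction\<close>

definition passed :: "nat set \<Rightarrow> nat \<Rightarrow> bool" where
  "passed U q \<longleftrightarrow> (let x = q mod n; y = q div n mod n; d = q div (n * n) in
     x \<noteq> y \<longrightarrow> x \<in> U \<longrightarrow> y \<in> U \<longrightarrow>
     (\<forall>a\<in>U - {x, y}. (Min (U - {x, y}), a) \<in> (Restr (dir d) (U - {x, y}))\<^sup>*))"

text \<open>The codes with \<open>d = 0\<close> and \<open>d = 1\<close> together say that the
  minimum reaches, and is reached from, every vertex that remains after deleting a pair.\<close>

lemma passed_all_imp_triconnected:
  assumes U: "U \<subseteq> {..<n}" "4 \<le> card U" and all: "\<And>q. q < 2 * (n * n) \<Longrightarrow> passed U q"
  shows "triconnected E U"
proof -
  have "strong_on E (U - {x, y})" if xy: "x \<in> U" "y \<in> U" "x \<noteq> y" for x y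
  proof -
    have n: "x < n" "y < n" using xy U by auto
    have "(Min (U - {x, y}), a) \<in> (Restr (dir d) (U - {x, y}))\<^sup>*" if a: "a \<in> U - {x, y}" and d: "d < 2" for a d
    proof -
      \<comment> \<open>The code that \<open>passed\<close> decodes to \<open>x\<close>,
        \<open>y\<close> and \<open>d\<close>.\<close>
      let ?q = "(d * n + y) * n + x"
      have y: "d * n + y < 2 * n" using d n by (auto simp: less_2_cases_iff)
      have "?q < (d * n + y + 1) * n" using n by simp
      also have "\<dots> \<le> 2 * n * n" using y by (intro mult_le_mono1) simp
      finally have q: "?q < 2 * (n * n)" by simp
      have "?q mod n = x" "?q div n = d * n + y" using n by simp_all
      moreover have "(d * n + y) mod n = y" "(d * n + y) div n = d" using n by simp_all
      ultimately show ?thesis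
        using all[OF q] xy a by (simp add: passed_def Let_def div_mult2_eq)
    qed
    from this[of _ 0] this[of _ 1] show ?thesis
      by (intro strong_on_if_reachable_both_ways[of _ "Min (U - {x, y})"]) (auto simp: dir_def)
  qed
  with U(2) show ?thesis by (simp add: triconnected_def)
qed

lemma row_cong: "arr s' ''row'' = arr s ''row'' \<Longrightarrow> row s' = row s"
  and bits_cong: "arr s' ''row'' = arr s ''row'' \<Longrightarrow> bits s' \<longleftrightarrow> bits s"
  by (simp_all add: row_def bits_def fun_eq_iff)

text \<open>\<open>R'\<close> is prescribed up to index \<open>k\<close> only, since rows beyond the
  family have no meaning.\<close>

definition splittable :: "(nat \<Rightarrow> nat set) \<Rightarrow> nat \<Rightarrow> nat \<Rightarrow> (nat \<Rightarrow> nat set) \<Rightarrow> bool" where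
  "splittable R i k R' \<longleftrightarrow> (\<exists>x\<in>R i. \<exists>y\<in>R i. \<exists>S d. x \<noteq> y \<and> S \<subset> R i - {x, y} \<and> S \<noteq> {} \<and>
     dir d `` S \<inter> (R i - {x, y}) \<subseteq> S \<and>
     (\<forall>j\<le>k. R' j = (R(i := insert x (insert y S), k := R i - S)) j))"

lemma wp_check_pair:
  assumes n: "reg s0 ''n'' = n" and i: "reg s0 ''i'' < reg s0 ''k''" and k: "reg s0 ''k'' \<le> n + 1"
    and k': "3 < card (row s0 (reg s0 ''i'')) \<Longrightarrow> reg s0 ''k'' \<le> n"
    and b: "bits s0" and lists: "adj_lists s0" and q: "reg s0 ''q'' < 2 * (n * n)"
  shows "wp W check_pair (\<lambda>s t. t \<le> t0 + 900 * (n + m + 1) \<and> bits s \<and>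
     (row s = row s0 \<and> reg s ''k'' = reg s0 ''k'' \<and> reg s ''q'' = Suc (reg s0 ''q'') \<and>
        passed (row s0 (reg s0 ''i'')) (reg s0 ''q'') \<or>
      splittable (row s0) (reg s0 ''i'') (reg s0 ''k'') (row s) \<and>
        reg s ''k'' = Suc (reg s0 ''k'') \<and> reg s ''q'' = 0)) s0 t0"
proof -
  define i where "i = reg s0 ''i''"
  define k where "k = reg s0 ''k''"
  define q where "q = reg s0 ''q''"
  define x where "x = q mod n"
  define y where "y = q div n mod n"
  define d where "d = q div (n * n)"
  define U where "U = row s0 i"
  define Y where "Y = U - {x, y}"
  define Q where "Q = (\<lambda>(s :: state) t. t \<le> t0 + 900 * (n + m + 1) \<and> bits s \<and>
     (row s = row s0 \<and> reg s ''k'' = k \<and> reg s ''q'' = Suc q \<and> passed U q \<or>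
      splittable (row s0) i k (row s) \<and> reg s ''k'' = Suc k \<and> reg s ''q'' = 0))"
  have n0: "0 < n" using assms(7) by (cases n) auto
  have q: "q < 2 * (n * n)" using assms(7) by (simp add: q_def)
  have xy: "x < n" "y < n" using n0 by (simp_all add: x_def y_def)
  have d: "d < 2" unfolding d_def using q n0 by (simp add: div_less_iff_less_mult)
  have dn: "d * n \<le> n" using d by (auto simp: less_2_cases_iff)
  have ik: "i < k" "k \<le> n + 1" "i \<le> n" using assms(2,3) by (auto simp: i_def k_def)
  have U: "U \<subseteq> {..<n}" "finite U" by (auto simp: U_def row_def)
  have Yn: "Y \<subseteq> {..<n}" using U by (auto simp: Y_def)
  have qW: "q \<le> W" "n * n \<le> W" "n \<le> W" "Suc q \<le> W" "1 \<le> W" "2 \<le> W"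
    using q W_bounds by simp_all
  have cells: "i * n + x \<le> W" "i * n + y \<le> W" "i * n \<le> W" "i \<le> W"
    using cell_bound[of i x] cell_bound[of i y] ik xy qW by auto
  have bit: "arr s0 ''row'' (i * n + x) \<le> 1" "arr s0 ''row'' (i * n + y) \<le> 1"
    using b xy by (auto simp: bits_def)
  have inU: "x \<in> U \<longleftrightarrow> arr s0 ''row'' (i * n + x) = 1" "y \<in> U \<longleftrightarrow> arr s0 ''row'' (i * n + y) = 1"
    using xy by (auto simp: U_def row_def)
  have dW: "d * n \<le> W" by (rule order_trans[OF dn qW(3)])
  let ?s = "set_reg ''base'' (d * n) (set_reg ''y'' y (set_reg ''x'' x s0))"
  have rws: "row ?s = row s0" by (rule row_cong) simp
  have main: "wp W clear_marks
      (wp W search (wp W (If (Less (Reg ''qt'') (Reg ''cnt'')) split_row (incr ''q'')) Q)) ?s u"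
    if u: "u \<le> t0 + 100" and x: "x \<in> U" and y: "y \<in> U" and ne: "x \<noteq> y" for u
  proof (rule wp_conseq[OF wp_clear_marks], goal_cases)
    case (6 s1 t1)
    have fr1: "reg s1 ''n'' = n" "reg s1 ''i'' = i" "reg s1 ''k'' = k" "reg s1 ''q'' = q"
        "reg s1 ''x'' = x" "reg s1 ''y'' = y" "reg s1 ''base'' = d * n"
        "arr s1 ''row'' = arr s0 ''row''" "arr s1 ''off'' = arr s0 ''off''" "arr s1 ''adj'' = arr s0 ''adj''"
      using 6(2) n by (auto simp: same_def clear_marks_def clear_body_def i_def k_def q_def)
    have Yeq: "row ?s (reg ?s ''i'') - {reg ?s ''x'', reg ?s ''y''} = Y"
      using rws by (simp add: Y_def U_def i_def)
    have post: "reg s1 ''cnt'' = card Y" "reg s1 ''qt'' = (if Y = {} then 0 else 1)"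
      "Y \<noteq> {} \<Longrightarrow> arr s1 ''queue'' 0 = Min Y"
      "\<And>v. v < n \<Longrightarrow> arr s1 ''mark'' v = (if v \<notin> Y then 0 else if v = Min Y then 2 else 1)"
      "t1 \<le> u + 100 * (n + 1)"
      using 6(1)[unfolded Yeq] by blast+
    have lists1: "adj_lists s1" using lists by (simp add: adj_lists_def fr1)
    show ?case
    proof (rule wp_conseq[OF wp_search[OF fr1(1,7) d lists1 Yn post(2,3,4)]], goal_cases)
      case (3 s2 t2)
      have fr2: "reg s2 ''n'' = n" "reg s2 ''i'' = i" "reg s2 ''k'' = k" "reg s2 ''q'' = q"
        "reg s2 ''x'' = x" "reg s2 ''y'' = y" "reg s2 ''cnt'' = card Y"
        "arr s2 ''row'' = arr s0 ''row''"
        using 3(2) by (auto simp: same_def search_def search_body_def fr1 post(1))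
      have rw2: "row s2 = row s0" "bits s2" using row_cong[OF fr2(8)] bits_cong[OF fr2(8)] b by auto
      obtain S where S: "S \<subseteq> Y" "S = {v. v < n \<and> arr s2 ''mark'' v = 2}" "reg s2 ''qt'' = card S"
        "Y \<noteq> {} \<longrightarrow> S \<noteq> {}" "dir d `` S \<inter> Y \<subseteq> S" "\<forall>a\<in>S. (Min Y, a) \<in> (Restr (dir d) Y)\<^sup>*"
        using 3(1) by blast
      have t2: "t2 \<le> t1 + 100 * (2 * m + n + 1)" and mark: "\<And>v. v < n \<Longrightarrow> arr s2 ''mark'' v \<le> 2"
        using 3(1) by blast+
      have finY: "finite Y" using Yn by (rule finite_subset) simp
      have cards: "card S \<le> card Y" "card Y \<le> n"
        using card_mono[OF finY S(1)] card_mono[OF _ Yn] by simp_all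
      show ?case
      proof (cases "card S < card Y")
        case True
        then have SY: "S \<subset> Y" using S(1) by auto
        then have Sne: "S \<noteq> {}" using S(4) by auto
        have "card Y = card U - 2"
          using U(2) x y ne by (simp add: Y_def card_Diff_subset)
        moreover have "card S > 0" using Sne finY S(1) by (meson card_gt_0_iff finite_subset)
        \<comment> \<open>A splitting needs \<open>0 < card S < card U - 2\<close>, so it occurs
          only for rows for which \<open>k'\<close> guarantees room for one more row.\<close>
        ultimately have "card U > 3" using True by simp
        then have "k \<le> n" using k' by (simp add: U_def i_def k_def)
        have w: "wp W split_row Q s2 t3" if t3: "t3 \<le> t2 + 100" for t3
        proof (rule wp_conseq[OF wp_split_row[where S = S]], goal_cases)
          case (10 s t)
          have rows: "\<forall>j\<le>k. row s j = ((row s0)(i := insert x (insert y S), k := U - S)) j"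
            using 10(1) by (simp add: fr2 rw2 U_def)
          have "splittable (row s0) i k (row s)"
            unfolding splittable_def U_def[symmetric]
            by (rule bexI[of _ x], rule bexI[of _ y], rule exI[of _ S], rule exI[of _ d])
              (use ne SY Sne S(5) rows x y in \<open>simp_all add: Y_def\<close>)
          with 10(1) t3 t2 post(5) u show ?case
            by (simp add: Q_def fr2 rw2)
        qed (use ik \<open>k \<le> n\<close> rw2 mark x y S in \<open>simp_all add: fr2 U_def Y_def\<close>)
        then show ?thesis
          using True S(3) cards qW by (simp add: fr2)
      next
        case False
        then have "S = Y" using S(1) finY by (simp add: card_subset_eq cards(1) le_antisym)
        then have "passed U q"
          using S(6) by (simp add: passed_def Let_def x_def[symmetric] y_def[symmetric] d_def[symmetric] Y_def)
        then show ?thesis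
          using False S(3) cards qW rw2 t2 post(5) u
          by (simp add: fr2 Q_def row_def bits_def fun_eq_iff)
      qed
    qed
  qed (use n ik xy b in \<open>simp_all add: i_def bits_def\<close>)
  have "wp W check_pair Q s0 t0"
  proof (cases "x \<noteq> y \<and> x \<in> U \<and> y \<in> U")
    case True
    with main cells bit inU qW n dW xy show ?thesis
      by (simp add: check_pair_def i_def[symmetric] k_def[symmetric] q_def[symmetric]
          x_def[symmetric] y_def[symmetric] d_def[symmetric])
  next
    case False
    then have "passed U q"
      by (auto simp: passed_def Let_def x_def y_def)
    moreover have "bits (set_reg ''q'' (Suc q) ?s)" "row (set_reg ''q'' (Suc q) ?s) = row s0"
      using b row_cong[of "set_reg ''q'' (Suc q) ?s" s0] bits_cong[of "set_reg ''q'' (Suc q) ?s" s0] by simp_all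
    moreover have nt: "(x \<noteq> y \<and> arr s0 ''row'' (i * n + x) = Suc 0 \<and> arr s0 ''row'' (i * n + y) = Suc 0) = False"
      using False inU by simp
    ultimately show ?thesis
      using cells bit qW n dW xy
      by (simp add: check_pair_def i_def[symmetric] k_def[symmetric] q_def[symmetric]
          x_def[symmetric] y_def[symmetric] d_def[symmetric] Q_def nt)
  qed
  then show ?thesis by (simp only: Q_def U_def i_def k_def q_def)
qed

section \<open>The main loop and its amortised running time\<close>

definition outs :: "(nat \<Rightarrow> nat set) \<Rightarrow> nat \<Rightarrow> nat list list" where
  "outs R i = map (\<lambda>j. enum (R j)) (filter (\<lambda>j. 4 \<le> card (R j)) [0..<i])"

lemma outs_Suc: "outs R (Suc i) = outs R i @ (if 4 \<le> card (R i) then [enum (R i)] else [])"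
  by (simp add: outs_def)

lemma outs_cong: "(\<And>j. j < i \<Longrightarrow> R j = R' j) \<Longrightarrow> outs R i = outs R' i"
  unfolding outs_def by (intro map_cong filter_cong refl) auto

lemma family_cong: "(\<And>j. j < k \<Longrightarrow> R j = R' j) \<Longrightarrow> family E' R k \<longleftrightarrow> family E' R' k"
  by (simp add: family_def cong: conj_cong)

lemma tails_less: "fst ` E \<subseteq> {..<n}"
  using range by force

lemma card_tails: "card (fst ` E) \<le> n"
  using card_mono[OF _ tails_less] by simp

definition excess :: "(nat \<Rightarrow> nat set) \<Rightarrow> nat \<Rightarrow> nat" where
  "excess R k = (\<Sum>j<k. card (R j) - 3)"

lemma family_step:
  assumes fam: "family E R k" and i: "i < k" and sp: "splittable R i k R'"
  shows "family E R' (Suc k)" and "Suc (excess R' (Suc k)) \<le> excess R k"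
    and "\<And>j. j < i \<Longrightarrow> R' j = R j"
proof -
  obtain x y S d where *: "x \<in> R i" "y \<in> R i" "x \<noteq> y" "S \<subset> R i - {x, y}" "S \<noteq> {}"
     "dir d `` S \<inter> (R i - {x, y}) \<subseteq> S"
     "\<And>j. j \<le> k \<Longrightarrow> R' j = (R(i := insert x (insert y S), k := R i - S)) j"
    using sp unfolding splittable_def by blast
  have "dir d = E \<or> dir d = E\<inverse>" by (simp add: dir_def)
  from family_split[OF fam _ i *(1-5) this *(6)]
  have fs: "family E (R(i := insert x (insert y S), k := R i - S)) (Suc k)"
    "Suc (\<Sum>j<Suc k. card ((R(i := insert x (insert y S), k := R i - S)) j) - 3) \<le> excess R k"
    by (simp_all add: excess_def)
  have eq: "R' j = (R(i := insert x (insert y S), k := R i - S)) j" if "j < Suc k" for j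
    using *(7) that by simp
  show "family E R' (Suc k)" 
    using family_cong[of "Suc k" R' "R(i := insert x (insert y S), k := R i - S)"] eq fs(1) by blast
  have "excess R' (Suc k) = (\<Sum>j<Suc k. card ((R(i := insert x (insert y S), k := R i - S)) j) - 3)"
    unfolding excess_def using eq by (intro sum.cong) auto
  with fs(2) show "Suc (excess R' (Suc k)) \<le> excess R k" by simp
  show "R' j = R j" if "j < i" for j using *(7)[of j] that i by simp
qed

text \<open>One round for each value of \<open>q\<close>, and a last one that emits the row.\<close>

abbreviation "rounds \<equiv> 2 * (n * n) + 1"
abbreviation "round_cost \<equiv> 1000 * (n + m + 1)"

lemma wp_main:
  assumes n: "reg s0 ''n'' = n" and lists: "adj_lists s0" and b: "bits s0"
    and k: "reg s0 ''k'' = 1" and R: "row s0 0 = fst ` E"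
    and z: "reg s0 ''i'' = 0" "reg s0 ''q'' = 0" "reg s0 ''count'' = 0" "reg s0 ''pos'' = 0" "arr s0 ''start'' 0 = 0"
  shows "wp W (While (Less (Reg ''i'') (Reg ''k'')) main_body)
     (\<lambda>s t. (\<exists>R k. family E R k \<and> (\<forall>j<k. 4 \<le> card (R j) \<longrightarrow> triconnected E (R j)) \<and> output_lists s = outs R k) \<and>
        t \<le> t0 + 10 + round_cost * rounds * (2 * (card (fst ` E) - 3) + 1)) s0 t0"
proof -
  define CD where "CD = round_cost * rounds"
  define B where "B = t0 + CD * (2 * (card (fst ` E) - 3) + 1)"
  txt \<open>
    The time clause says that the time left suffices for \<open>2 * excess + k - i\<close> more
    rounds over all \<open>q\<close>: a splitting increases \<open>k\<close> by one but decreases the excess, and a finished row increases \<open>i\<close>.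
  \<close>
  define I where "I = (\<lambda>(s :: state) t. (let i = reg s ''i''; k = reg s ''k''; q = reg s ''q'' in
     i \<le> k \<and> (i = k \<longrightarrow> q = 0) \<and> q \<le> 2 * (n * n) \<and> family E (row s) k \<and> bits s \<and>
     (\<forall>j<i. 4 \<le> card (row s j) \<longrightarrow> triconnected E (row s j)) \<and> (\<forall>q'<q. passed (row s i) q') \<and>
     out_inv s (outs (row s) i) \<and> reg s ''pos'' \<le> i * n \<and> reg s ''count'' \<le> i \<and>
     t + CD * (2 * excess (row s) k + k) \<le> B + CD * i + round_cost * q))"
  show ?thesis
  proof (rule wp_While[where I = I and B = B], goal_cases)
    case 1
    have "family E (row s0) 1" using R by (rule family_init)
    moreover have "excess (row s0) 1 = card (fst ` E) - 3" by (simp add: excess_def R)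
    ultimately show ?case
      using b by (simp add: I_def k z B_def out_inv_def output_lists_def outs_def)
  next
    case (2 s t)
    define i where "i = reg s ''i''"
    define k where "k = reg s ''k''"
    define q where "q = reg s ''q''"
    have I: "i \<le> k" "i = k \<longrightarrow> q = 0" "q \<le> 2 * (n * n)" "family E (row s) k"
      "t + CD * (2 * excess (row s) k + k) \<le> B + CD * i + round_cost * q"
      using 2(1) by (simp_all add: I_def Let_def i_def k_def q_def)
    \<comment> \<open>The rounds of the unfinished scan of row \<open>i\<close> are covered by the
      allowance for that row, as \<open>i < k\<close> whenever \<open>q > 0\<close>.\<close>
    have "CD * i + round_cost * q \<le> CD * k"
    proof (cases "i = k")
      case False
      then have "CD * (i + 1) \<le> CD * k" using I(1) by (intro mult_le_mono2) simp
      moreover have "round_cost * q \<le> CD" unfolding CD_def using I(3) by (intro mult_le_mono2) simp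
      ultimately show ?thesis by simp
    qed (use I in simp)
    then have "t \<le> B" using I(5) by (simp add: algebra_simps)
    moreover have "k \<le> n + 1" using I(4) card_tails by (auto simp: family_def)
    ultimately show ?case using I(1) W_bounds by (simp add: i_def k_def)
  next
    case (3 s t)
    define i where "i = reg s ''i''"
    define k where "k = reg s ''k''"
    define q where "q = reg s ''q''"
    define R where "R = row s"
    have ik: "i < k" using 3(3) by (simp add: i_def k_def)
    have I: "q \<le> 2 * (n * n)" "family E R k" "bits s"
      "\<And>j. j < i \<Longrightarrow> 4 \<le> card (R j) \<Longrightarrow> triconnected E (R j)" "\<And>q'. q' < q \<Longrightarrow> passed (R i) q'"
      "out_inv s (outs R i)" "reg s ''pos'' \<le> i * n" "reg s ''count'' \<le> i"
      "t + CD * (2 * excess R k + k) \<le> B + CD * i + round_cost * q"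
      using 3(1) by (simp_all add: I_def Let_def i_def k_def q_def R_def)
    have fr: "reg s ''n'' = n" "arr s ''off'' = arr s0 ''off''" "arr s ''adj'' = arr s0 ''adj''"
      using 3(2) n by (auto simp: same_def main_body_def check_pair_def clear_marks_def clear_body_def
        search_def search_body_def split_row_def split_body_def emit_row_def emit_body_def)
    have lists': "adj_lists s" using lists by (simp add: adj_lists_def fr)
    have kex: "k + excess R k \<le> 1 + (card (fst ` E) - 3)"
      using I(2) by (simp add: family_def excess_def)
    have kn: "k \<le> n + 1" using kex card_tails by simp
    have W: "n * n \<le> W" "2 * (n * n) \<le> W" "2 \<le> W" "n \<le> W" "q \<le> W" "k \<le> W" "Suc i \<le> W" "Suc 0 \<le> W"
      using W_bounds I(1) kn ik by simp_all
    show ?case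
    proof (cases "q < 2 * (n * n)")
      case True
      \<comment> \<open>A row with more than three vertices contributes at least 1 to the excess,
        which by the last clause of \<open>family\<close> keeps \<open>k\<close> below its
        maximum.\<close>
      have k': "k \<le> n" if "3 < card (R i)"
      proof -
        have "1 \<le> card (R i) - 3" using that by simp
        also have "\<dots> \<le> excess R k"
          unfolding excess_def using ik by (intro member_le_sum) auto
        finally show ?thesis using kex card_tails by simp
      qed
      have "wp W check_pair I s u" if u: "u \<le> t + 50" for u
      proof (rule wp_conseq[OF wp_check_pair], goal_cases)
        case (8 s' t')
        have fr': "reg s' ''i'' = i" "reg s' ''pos'' = reg s ''pos''" "reg s' ''count'' = reg s ''count''"
          "arr s' ''start'' = arr s ''start''" "arr s' ''out'' = arr s ''out''"
          using 8(2) by (auto simp: same_def check_pair_def clear_marks_def clear_body_def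
            search_def search_body_def split_row_def split_body_def i_def)
        have o: "out_inv s' (outs R i)"
          using I(6) by (rule out_inv_cong) (simp_all add: fr')
        have t': "t' \<le> t + round_cost" and b': "bits s'"
          using 8(1) u by auto
        from 8(1) consider
            (pass) "row s' = R" "reg s' ''k'' = k" "reg s' ''q'' = Suc q" "passed (R i) q"
          | (split) "splittable R i k (row s')" "reg s' ''k'' = Suc k" "reg s' ''q'' = 0"
          by (auto simp: R_def i_def k_def q_def)
        then show ?case
        proof cases
          case pass
          have "\<And>q'. q' < Suc q \<Longrightarrow> passed (R i) q'"
            using I(5) pass(4) by (auto simp: less_Suc_eq)
          then show ?thesis
            using I(2,4,7-9) True ik o t' b' by (simp add: I_def Let_def fr' pass algebra_simps)
        next
          case split
          note fs = family_step[OF I(2) ik split(1)]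
          have "outs (row s') i = outs R i" using fs(3) by (rule outs_cong)
          \<comment> \<open>The reason for the factor 2: a splitting lowers the excess and so frees
            two full scans, one for the new row and one for the scan of row \<open>i\<close> that is
            abandoned.\<close>
          moreover have "CD * (2 * excess (row s') (Suc k) + Suc k) + CD \<le> CD * (2 * excess R k + k)"
          proof -
            have "CD * (2 * excess (row s') (Suc k) + Suc k + 1) \<le> CD * (2 * excess R k + k)"
              using fs(2) by (intro mult_le_mono2) simp
            then show ?thesis by (simp add: algebra_simps)
          qed
          moreover have "round_cost * q + round_cost \<le> CD"
          proof -
            have "round_cost * (q + 1) \<le> CD" unfolding CD_def using True by (intro mult_le_mono2) simp
            then show ?thesis by (simp add: algebra_simps)
          qed
          ultimately have "t' + CD * (2 * excess (row s') (Suc k) + Suc k) \<le> B + CD * i"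
            using I(9) t' by linarith
          then show ?thesis
            using fs I(4,7,8) ik o b' \<open>outs (row s') i = outs R i\<close>
            by (simp add: I_def Let_def fr' split)
        qed
      qed (use fr ik kn k' I(3) lists' True in \<open>simp_all add: i_def k_def q_def R_def\<close>)
      then show ?thesis
        using True W fr by (simp add: main_body_def q_def[symmetric])
    next
      case False
      then have q: "q = 2 * (n * n)" using I(1) by simp
      have fam_i: "R i \<subseteq> {..<n}" by (auto simp: R_def row_def)
      have triconnected: "4 \<le> card (R i) \<Longrightarrow> triconnected E (R i)"
        using passed_all_imp_triconnected[OF fam_i] I(5) by (simp add: q)
      have "wp W emit_row (wp W (incr ''i'') (wp W (Assign ''q'' (Const 0)) I)) s u" if u: "u \<le> t + 50" for u
      proof (rule wp_conseq[OF wp_emit_row[where L = "outs R i"]], goal_cases)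
        case (7 s' t')
        have fr': "reg s' ''i'' = i" "reg s' ''k'' = k" "arr s' ''row'' = arr s ''row''"
          using 7(2) by (auto simp: same_def emit_row_def emit_body_def i_def k_def)
        have rw: "row s' = R" "bits s'" using row_cong[OF fr'(3)] bits_cong[OF fr'(3)] I(3) by (auto simp: R_def)
        have o: "out_inv s' (outs R (Suc i))" "reg s' ''pos'' \<le> Suc i * n" "reg s' ''count'' \<le> Suc i"
          "t' \<le> u + 100 * (n + 1)"
          using 7(1) by (auto simp: outs_Suc R_def i_def)
        define s2 where "s2 = set_reg ''q'' 0 (set_reg ''i'' (Suc i) s')"
        have s2: "reg s2 ''i'' = Suc i" "reg s2 ''k'' = k" "reg s2 ''q'' = 0" "reg s2 ''pos'' = reg s' ''pos''"
          "reg s2 ''count'' = reg s' ''count''" "row s2 = R" "bits s2"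
          using rw row_cong[of s2 s'] bits_cong[of s2 s'] by (simp_all add: s2_def fr')
        have o2: "out_inv s2 (outs R (Suc i))"
          using o(1) by (rule out_inv_cong) (simp_all add: s2_def)
        have cq: "round_cost * q + round_cost = CD"
          by (simp add: CD_def q algebra_simps)
        have "t' + 20 + CD * (2 * excess R k + k) \<le> B + CD * Suc i"
          using I(9) cq o(4) u by simp
        moreover have "\<And>j. j < Suc i \<Longrightarrow> 4 \<le> card (R j) \<Longrightarrow> triconnected E (R j)"
          using I(4) triconnected by (auto simp: less_Suc_eq)
        ultimately have "I s2 t3" if "t3 \<le> t' + 20" for t3
          unfolding I_def Let_def s2 using ik I(2) o o2 that s2(7) by simp
        then show ?case using W by (simp add: fr' s2_def)
      qed (use fr ik kn I in \<open>simp_all add: i_def k_def R_def\<close>)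
      then show ?thesis
        using q W fr by (simp add: main_body_def q_def[symmetric])
    qed
  next
    case (4 s t)
    have ik: "reg s ''i'' = reg s ''k''" using 4(1,3) by (simp add: I_def Let_def)
    then have I: "family E (row s) (reg s ''k'')" "\<forall>j<reg s ''k''. 4 \<le> card (row s j) \<longrightarrow> triconnected E (row s j)"
      "output_lists s = outs (row s) (reg s ''k'')" "t \<le> B"
      using 4(1) by (auto simp: I_def Let_def out_inv_def algebra_simps)
    then show ?case
      by (auto simp: B_def CD_def)
  qed
qed

lemma wp_program:
  assumes g: "graph_input s0"
    and z: "reg s0 ''i'' = 0" "reg s0 ''q'' = 0" "reg s0 ''count'' = 0" "reg s0 ''pos'' = 0"
      "arr s0 ''start'' 0 = 0" "\<And>v. arr s0 ''row'' v = 0"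
  shows "wp W program
     (\<lambda>s t. (\<exists>R k. family E R k \<and> (\<forall>j<k. 4 \<le> card (R j) \<longrightarrow> triconnected E (R j)) \<and> output_lists s = outs R k) \<and>
        t \<le> 20000 * ((max 1 n) ^ 3 * max 1 m)) s0 0"
proof -
  have T: "100 * (m + 1) * (2 * n + 1) + 50 * (m + 1) + 10 +
      round_cost * rounds * (2 * (card (fst ` E) - 3) + 1) \<le> 20000 * ((max 1 n) ^ 3 * max 1 m)"
  proof -
    \<comment> \<open>The maxima with 1 absorb the constant overhead that remains when there are no
      vertices or no arcs.\<close>
    define a where "a = max 1 n"
    define b where "b = max 1 m"
    define F where "F = 2 * (card (fst ` E) - 3) + 1"
    have ab: "1 \<le> a" "1 \<le> b" "n \<le> a" "m \<le> b" by (simp_all add: a_def b_def)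
    have Fa: "F \<le> 2 * a" using card_tails by (auto simp: F_def a_def)
    have "card (fst ` E) \<le> m"
      using card_image_le[of E fst] card_length[of es] by simp
    then have Fb: "F \<le> 2 * b" by (auto simp: F_def b_def)
    have "n * n \<le> a * a" by (rule mult_le_mono[OF ab(3) ab(3)])
    moreover have "1 \<le> a * a" using mult_le_mono[OF ab(1) ab(1)] by (simp only: mult_1)
    ultimately have "rounds \<le> 3 * (a * a)" by linarith
    \<comment> \<open>\<open>F\<close> is bounded by \<open>2 * a\<close> and by
      \<open>2 * b\<close>: the part of the sum that stems from \<open>n\<close> is multiplied by
      the second bound, the part that stems from \<open>m\<close> by the first. The second bound
      exists because the scan starts with tails only.\<close>
    moreover have "(n + m + 1) * F \<le> 6 * (a * b)"
    proof -
      have "(n + m + 1) * F \<le> (2 * a + b) * F" using ab by (intro mult_le_mono1) simp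
      also have "\<dots> = 2 * a * F + b * F" by (simp add: algebra_simps)
      also have "\<dots> \<le> 2 * a * (2 * b) + b * (2 * a)"
        using Fa Fb by (intro add_mono mult_le_mono2)
      finally show ?thesis by simp
    qed
    ultimately have "rounds * ((n + m + 1) * F) \<le> 3 * (a * a) * (6 * (a * b))"
      by (rule mult_le_mono)
    then have 1: "round_cost * rounds * F \<le> 18000 * (a ^ 3 * b)"
      by (simp add: power3_eq_cube algebra_simps)
    have "(m + 1) * (2 * n + 1) \<le> (2 * b) * (3 * a)" using ab by (intro mult_le_mono) simp_all
    then have 2: "100 * (m + 1) * (2 * n + 1) \<le> 600 * (a * b)" by (simp add: algebra_simps)
    have a3: "a \<le> a ^ 3" using ab(1) by (simp add: self_le_power)
    then have 3: "a * b \<le> a ^ 3 * b" by (rule mult_le_mono1)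
    have "b \<le> a * b" using mult_le_mono1[OF ab(1), of b] by (simp only: mult_1)
    then have "m \<le> a * b" "1 \<le> a * b" using ab(2,4) by (blast intro: order_trans)+
    moreover have "50 * (m + 1) + 10 \<le> 110 * c" if "m \<le> c" "1 \<le> c" for c :: nat using that by simp
    ultimately have "50 * (m + 1) + 10 \<le> 110 * (a * b)" by blast
    \<comment> \<open>The contributions are 18000 = 1000 * 3 * 6 for the main loop, 600 for the
      adjacency lists and 110 for the rest, hence below 20000.\<close>
    with 1 2 3 show ?thesis unfolding a_def[symmetric] b_def[symmetric] F_def[symmetric] by linarith
  qed
  define Q where "Q = (\<lambda>s t. (\<exists>R k. family E R k \<and> (\<forall>j<k. 4 \<le> card (R j) \<longrightarrow> triconnected E (R j)) \<and> output_lists s = outs R k) \<and>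
        t \<le> 20000 * ((max 1 n) ^ 3 * max 1 m))"
  have "wp W build_adj (wp W init_row (wp W (While (Less (Reg ''i'') (Reg ''k'')) main_body) Q)) s0 0"
  proof (rule wp_conseq[OF wp_build_adj[OF g]], goal_cases)
    case (1 s1 t1)
    have fr1: "graph_input s1" "reg s1 ''i'' = 0" "reg s1 ''q'' = 0" "reg s1 ''count'' = 0" "reg s1 ''pos'' = 0"
      "arr s1 ''start'' 0 = 0" "\<And>v. arr s1 ''row'' v = 0"
      using 1(2) g z by (simp_all add: same_def build_adj_def node_body_def arc_body_def graph_input_def)
    show ?case
    proof (rule wp_conseq[OF wp_init_row[OF fr1(1,7)]], goal_cases)
      case (1 s2 t2)
      have fr2: "reg s2 ''n'' = n" "reg s2 ''i'' = 0" "reg s2 ''q'' = 0" "reg s2 ''count'' = 0" "reg s2 ''pos'' = 0"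
        "arr s2 ''start'' 0 = 0" "arr s2 ''off'' = arr s1 ''off''" "arr s2 ''adj'' = arr s1 ''adj''"
        using 1(2) fr1 by (simp_all add: same_def init_row_def mark_tail_def graph_input_def)
      have l: "adj_lists s2" using \<open>adj_lists s1 \<and> _\<close> by (simp add: adj_lists_def fr2)
      have row: "row s2 0 = fst ` E" using 1(1) range by (auto simp: row_def)
      have b: "bits s2" using 1(1) by (auto simp: bits_def)
      have k: "reg s2 ''k'' = 1" using 1(1) by simp
      show ?case
      proof (rule wp_conseq[OF wp_main[OF fr2(1) l b k row fr2(2-6)]], goal_cases)
        case (1 s3 t3)
        have "t3 \<le> 20000 * ((max 1 n) ^ 3 * max 1 m)"
          using 1(1) \<open>_ \<and> _ \<and> t2 \<le> _\<close> \<open>adj_lists s1 \<and> _\<close> T by linarith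
        with 1(1) show ?case by (simp add: Q_def)
      qed
    qed
  qed
  then have "wp W program Q s0 0" by (simp add: program_def)
  then show ?thesis by (simp only: Q_def)
qed

section \<open>From vertex numbers back to vertices\<close>

lemma outputs_family_outs:
  assumes fam: "family E R k" and triconnected: "\<And>j. j < k \<Longrightarrow> 4 \<le> card (R j) \<Longrightarrow> triconnected E (R j)"
    and out: "output_lists s = outs R k" and vs: "length vs = n" "distinct vs"
  shows "outputs_family vs s (maximal_triconnected ((\<lambda>(i, j). (vs ! i, vs ! j)) ` E))"
proof -
  let ?J = "{j. j < k \<and> 4 \<le> card (R j)}"
  note ff = family_final[OF fam finite_set triconnected]
  have sub: "R j \<subseteq> {..<n}" if "j < k" for j
  proof -
    have "R j \<subseteq> fst ` E" using fam that by (simp add: family_def)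
    with tails_less show ?thesis by blast
  qed
  have enum: "set (enum (R j)) = R j" if "j < k" for j
    using sub[OF that] by (auto simp: enum_def)
  have inj: "inj_on ((!) vs) {..<n}"
    using vs by (auto simp: inj_on_def nth_eq_iff_index_eq)
  have js: "set (filter (\<lambda>j. 4 \<le> card (R j)) [0..<k]) = ?J" by auto
  have sets: "map set (outs R k) = map R (filter (\<lambda>j. 4 \<le> card (R j)) [0..<k])"
    by (simp add: outs_def enum)
  have "distinct (map set (outs R k))"
    unfolding sets distinct_map js using ff(2) by simp
  moreover have "\<forall>xs\<in>set (outs R k). distinct xs \<and> set xs \<subseteq> {..<n}"
    by (auto simp: outs_def enum_def)
  moreover have "(\<lambda>xs. (!) vs ` set xs) ` set (outs R k) = maximal_triconnected ((\<lambda>(i, j). (vs ! i, vs ! j)) ` E)"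
  proof -
    have "(\<lambda>xs. (!) vs ` set xs) ` set (outs R k) = (\<lambda>C. (!) vs ` C) ` set (map set (outs R k))"
      by (simp add: image_image)
    also have "set (map set (outs R k)) = maximal_triconnected E"
      unfolding sets set_map js by (rule ff(1))
    also have "(\<lambda>C. (!) vs ` C) ` maximal_triconnected E = maximal_triconnected (map_prod ((!) vs) ((!) vs) ` E)"
      using maximal_triconnected_image[OF inj range] by simp
    finally show ?thesis by (simp add: map_prod_def)
  qed
  ultimately show ?thesis by (simp add: outputs_family_def out vs(1))
qed

end

theorem theorem5:
  shows "computable_in_time
    (\<lambda>G :: 'a pair_pre_digraph. vertex_connected_components 3 (with_proj G))
    (\<lambda>n m. (max 1 n) ^ 3 * max 1 m)"
proof -
  have *: "\<exists>t s. exec ((n + m + 2) ^ 4) program (input_state n es) t s \<and>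
      t \<le> 20000 * ((max 1 n) ^ 3 * max 1 m) \<and>
      outputs_family vs s (vertex_connected_components 3 (with_proj G))"
    if G: "pair_fin_digraph G" and rep: "represents vs es G"
      and n: "n = card (pverts G)" and m: "m = card (parcs G)"
    for G :: "'a pair_pre_digraph" and vs es n m
  proof -
    interpret pair_fin_digraph G by fact
    have vs: "distinct vs" "set vs = pverts G" and es: "distinct es" "set es \<subseteq> {..<length vs} \<times> {..<length vs}"
      and arcs: "parcs G = (\<lambda>(i, j). (vs ! i, vs ! j)) ` set es"
      using rep by (auto simp: represents_def)
    have ln: "length vs = n" using vs n distinct_card by fastforce
    have inj: "inj_on ((!) vs) {..<length vs}" using vs(1) by (rule inj_on_nth) simp
    \<comment> \<open>Different pairs of numbers denote different arcs, so the length of the input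
      list is the number of arcs.\<close>
    have "inj_on (map_prod ((!) vs) ((!) vs)) (set es)"
      by (rule inj_on_subset[OF map_prod_inj_on[OF inj inj] es(2)])
    then have lm: "length es = m"
      using m arcs es(1) by (simp add: map_prod_def card_image distinct_card)
    \<comment> \<open>The origin of the exponent 4: with \<open>N = n + m + 2 \<ge> 2\<close>, the
      factor 4 is at most \<open>N * N\<close>.\<close>
    have "4 * N * N \<le> N ^ 4" if "2 \<le> N" for N :: nat
      using mult_le_mono1[OF mult_le_mono[OF that that], of "N * N"]
      by (simp add: power4_eq_xxxx mult.assoc)
    from this[of "n + m + 2"] interpret arc_list es n "(n + m + 2) ^ 4"
      using es(2) by unfold_locales (simp_all only: ln lm le_add2)
    have g: "graph_input (input_state n es)" by (simp add: graph_input_def input_state_def)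
    have "wp ((n + m + 2) ^ 4) program
     (\<lambda>s t. (\<exists>R k. family E R k \<and> (\<forall>j<k. 4 \<le> card (R j) \<longrightarrow> triconnected E (R j)) \<and> output_lists s = outs R k) \<and>
        t \<le> 20000 * ((max 1 n) ^ 3 * max 1 (length es))) (input_state n es) 0"
      by (rule wp_program[OF g]) (simp_all add: input_state_def)
    then obtain t s R k where ex: "exec ((n + m + 2) ^ 4) program (input_state n es) t s"
      and fam: "family E R k" "\<And>j. j < k \<Longrightarrow> 4 \<le> card (R j) \<Longrightarrow> triconnected E (R j)" "output_lists s = outs R k"
      and t: "t \<le> 20000 * ((max 1 n) ^ 3 * max 1 m)"
      unfolding wp_def lm by auto
    have "vertex_connected_components 3 (with_proj G) = maximal_triconnected (parcs G)"
      using vertex_connected_components_3 by simp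
    with outputs_family_outs[OF fam ln vs(1)] ex t show ?thesis
      by (auto simp: arcs)
  qed
  show ?thesis
    unfolding computable_in_time_def Let_def
    by (rule exI[of _ program], rule exI[of _ 20000], rule exI[of _ 4], intro allI impI, elim conjE)
      (rule *[OF _ _ refl refl])
qed

end
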